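(* Let $n\ge 2$, let $K\subset\mathbb{R}^n$ be a bounded convex open set, and let $d_K$ be the Hilbert metric on $K$. Then $(K,d_K)$ is a Busemann non-positive curvature space if and only if $(K,d_K)$ is an Alexandrov non-positive curvature space.
   Context: **Hilbert metric.** For a bounded convex open set $K\subset\mathbb{R}^n$ ($n\ge 2$), put $d_K(x,x)=0$ for $x\in K$. For distinct $x,y\in K$, let $a,b\in\partial K$ be the two points where the straight line through $x,y$ meets $\partial K$, labelled so that the order of the points on the line is $a,x,y,b$. Define $$d_K(x,y)=\frac12\ln\left(\frac{\|y-a\|}{\|x-a\|}\cdot\frac{\|x-b\|}{\|y-b\|}\right),$$ where $\|\cdot\|$ is the Euclidean norm. This is a metric on $K$. **Geodesics.** Let $(M,d)$ be a metric space. The length of a curve $\gamma:[0,1]\to M$ is $$\ell(\gamma)=\sup\left\{\sum_{i=1}^{N} d(\gamma(t_{i-1}),\gamma(t_i)) : 0=t_0<t_1<\dots<t_N=1,\ N\in\mathbb{N}\right\}.$$ A curve $\gamma$ is a shortest geodesic from $\gamma(0)$ to $\gamma(1)$ if $\ell(\gamma)=d(\gamma(0),\gamma(1))$. Shortest geodesics are always parametrized proportionally to arc length. The space $(M,d)$ is a geodesic space if any two of its points are joined by a shortest geodesic. It is a locally geodesic space if this property holds in an appropriate neighborhood of any point. Write $B(p,\delta)$ for the metric ball of radius $\delta$ around $p$. **Alexandrov non-positive curvature.** A locally geodesic space $(M,d)$ is an Alexandrov non-positive curvature space if for every $p\in M$ there exists $\delta_p>0$ such that for all $x,y,z\in B(p,\delta_p)$,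 every shortest geodesic $\gamma:[0,1]\to M$ with $\gamma(0)=x$, $\gamma(1)=z$, and every $t\in[0,1]$, $$d^2(y,\gamma(t))\le (1-t)\,d^2(y,x)+t\,d^2(y,z)-t(1-t)\,d^2(x,z).$$ **Busemann non-positive curvature.** A locally geodesic space $(M,d)$ is a Busemann non-positive curvature space if for every $p\in M$ there exists $\delta_p>0$ such that for any two shortest geodesics $\gamma_1,\gamma_2:[0,1]\to M$ with $\gamma_1(0)=\gamma_2(0)\in B(p,\delta_p)$ and with endpoints $\gamma_1(1),\gamma_2(1)\in B(p,\delta_p)$, $$d\left(\gamma_1(\tfrac12),\gamma_2(\tfrac12)\right)\le \tfrac12\, d(\gamma_1(1),\gamma_2(1)).$$ *)

theory Defs
  imports "HOL-Analysis.Analysis"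
begin

section \<open>The Hilbert metric\<close>

(* The point at which the ray from x through y leaves K. For distinct x, y in a bounded convex
   open K it exists and is unique, see hilbert_end_unique. The boundary points a, b on the line
   through x and y, in the order a, x, y, b, are a = hilbert_end K y x and b = hilbert_end K x y. *)
definition hilbert_end :: "(real ^ 'n) set \<Rightarrow> real ^ 'n \<Rightarrow> real ^ 'n \<Rightarrow> real ^ 'n" where
  "hilbert_end K x y = (THE b. b \<in> frontier K \<and> y \<in> open_segment x b)"

(* Only the values for x, y in K matter; outside K the value is set to 0 so that the function
   fits the locale Metric_space, which requires symmetry and nonnegativity everywhere. *)
definition hilbert_dist :: "(real ^ 'n) set \<Rightarrow> real ^ 'n \<Rightarrow> real ^ 'n \<Rightarrow> real" where
  "hilbert_dist K x y =
    (if x \<in> K \<and> y \<in> K \<and> x \<noteq> y then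
       (let a = hilbert_end K y x; b = hilbert_end K x y
        in 1 / 2 * ln (norm (y - a) / norm (x - a) * (norm (x - b) / norm (y - b))))
     else 0)"

lemma hilbert_end_unique:
  fixes K :: "(real ^ 'n) set"
  assumes "bounded K" "convex K" "open K" "x \<in> K" "y \<in> K" "x \<noteq> y"
  shows "\<exists>!b. b \<in> frontier K \<and> y \<in> open_segment x b"
proof -
  have int: "interior K = K" using \<open>open K\<close> by (simp add: interior_open)
  obtain d where d: "d > 0" "y + d *\<^sub>R (y - x) \<in> frontier K"
    by (rule ray_to_frontier[of K y "y - x"]) (use assms int in auto)
  define b where "b = y + d *\<^sub>R (y - x)"
  have "(1 / (1 + d)) *\<^sub>R (b - x) = y - x"
  proof -
    have "b - x = (1 + d) *\<^sub>R (y - x)"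
      by (simp add: b_def scaleR_left_distrib)
    then show ?thesis using d by simp
  qed
  then have "y = (1 - 1 / (1 + d)) *\<^sub>R x + (1 / (1 + d)) *\<^sub>R b"
    by (simp add: algebra_simps)
  moreover have "x \<noteq> b"
  proof
    assume "x = b"
    then have "(1 + d) *\<^sub>R (y - x) = 0" by (simp add: b_def algebra_simps)
    then show False using d assms by simp
  qed
  ultimately have "y \<in> open_segment x b"
    unfolding in_segment using d by (intro conjI exI[of _ "1 / (1 + d)"]) auto
  moreover have "c = c'"
    if c: "c \<in> frontier K" "y \<in> open_segment x c"
      and c': "c' \<in> frontier K" "y \<in> open_segment x c'" for c c'
  proof -
    have in_ray: "\<exists>s>0. e = y + s *\<^sub>R (y - x)" if "y \<in> open_segment x e" for e
    proof -
      obtain u where u: "0 < u" "u < 1" "y = (1 - u) *\<^sub>R x + u *\<^sub>R e"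
        using \<open>y \<in> open_segment x e\<close> by (auto simp: in_segment)
      have "y - x = u *\<^sub>R (e - x)" using u(3) by (simp add: algebra_simps)
      then have e: "(1 / u) *\<^sub>R (y - x) = e - x" using u by simp
      have "(1 / u - 1) *\<^sub>R (y - x) = (e - x) - (y - x)"
        by (simp only: scaleR_left_diff_distrib scaleR_one e)
      then have "e = y + (1 / u - 1) *\<^sub>R (y - x)" by simp
      moreover have "1 / u - 1 > 0" using u(1,2) by (simp add: field_simps)
      ultimately show ?thesis by blast
    qed
    have no: False
      if "0 < s" "s < t" "y + s *\<^sub>R (y - x) \<in> frontier K" "y + t *\<^sub>R (y - x) \<in> frontier K"
      for s t
    proof -
      have "y + s *\<^sub>R (y - x) \<in> open_segment y (y + t *\<^sub>R (y - x))"
        unfolding in_segment using that assms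
        by (intro conjI exI[of _ "s / t"]) (auto simp: algebra_simps)
      moreover have "open_segment y (y + t *\<^sub>R (y - x)) \<subseteq> interior K"
        using that assms int
        by (intro in_interior_closure_convex_segment) (auto simp: frontier_def)
      ultimately show False using that by (auto simp: frontier_def)
    qed
    obtain s s' where "s > 0" "c = y + s *\<^sub>R (y - x)" "s' > 0" "c' = y + s' *\<^sub>R (y - x)"
      using in_ray c(2) c'(2) by blast
    then show ?thesis using no[of s s'] no[of s' s] c(1) c'(1) by (cases s s' rule: linorder_cases) auto
  qed
  ultimately show ?thesis using d b_def by blast
qed

section \<open>Geodesics and non-positive curvature in metric spaces\<close>

context Metric_space
begin

(* Length of the restriction of \<gamma> to [a, b]. Partition points are t 0, ..., t N, where N may be 0
   so that the length over [a, a] is 0; for a < b necessarily N >= 1. *)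
definition curve_length :: "(real \<Rightarrow> 'a) \<Rightarrow> real \<Rightarrow> real \<Rightarrow> ereal" where
  "curve_length \<gamma> a b =
    Sup {ereal (\<Sum>i=1..N. d (\<gamma> (t (i - 1))) (\<gamma> (t i))) | (N::nat) (t::nat \<Rightarrow> real).
           t 0 = a \<and> t N = b \<and> strict_mono_on {0..N} t}"

(* The last conjunct is parametrization proportionally to arc length. *)
definition shortest_geodesic :: "(real \<Rightarrow> 'a) \<Rightarrow> bool" where
  "shortest_geodesic \<gamma> \<longleftrightarrow>
     pathin mtopology \<gamma> \<and>
     curve_length \<gamma> 0 1 = ereal (d (\<gamma> 0) (\<gamma> 1)) \<and>
     (\<forall>t\<in>{0..1}. curve_length \<gamma> 0 t = ereal t * curve_length \<gamma> 0 1)"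

(* The geodesics joining points of U are shortest geodesics of M and need not stay inside U. *)
definition locally_geodesic_space :: bool where
  "locally_geodesic_space \<longleftrightarrow>
     (\<forall>p\<in>M. \<exists>U. openin mtopology U \<and> p \<in> U \<and>
        (\<forall>x\<in>U. \<forall>y\<in>U. \<exists>\<gamma>. shortest_geodesic \<gamma> \<and> \<gamma> 0 = x \<and> \<gamma> 1 = y))"

definition alexandrov_npc_space :: bool where
  "alexandrov_npc_space \<longleftrightarrow>
     locally_geodesic_space \<and>
     (\<forall>p\<in>M. \<exists>\<delta>>0. \<forall>x\<in>mball p \<delta>. \<forall>y\<in>mball p \<delta>. \<forall>z\<in>mball p \<delta>.
        \<forall>\<gamma>. shortest_geodesic \<gamma> \<and> \<gamma> 0 = x \<and> \<gamma> 1 = z \<longrightarrow>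
          (\<forall>t\<in>{0..1}. (d y (\<gamma> t))\<^sup>2 \<le>
             (1 - t) * (d y x)\<^sup>2 + t * (d y z)\<^sup>2 - t * (1 - t) * (d x z)\<^sup>2))"

definition busemann_npc_space :: bool where
  "busemann_npc_space \<longleftrightarrow>
     locally_geodesic_space \<and>
     (\<forall>p\<in>M. \<exists>\<delta>>0. \<forall>\<gamma>\<^sub>1 \<gamma>\<^sub>2.
        shortest_geodesic \<gamma>\<^sub>1 \<and> shortest_geodesic \<gamma>\<^sub>2 \<and>
        \<gamma>\<^sub>1 0 = \<gamma>\<^sub>2 0 \<and> \<gamma>\<^sub>1 0 \<in> mball p \<delta> \<and> \<gamma>\<^sub>1 1 \<in> mball p \<delta> \<and> \<gamma>\<^sub>2 1 \<in> mball p \<delta> \<longrightarrow>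
          d (\<gamma>\<^sub>1 (1 / 2)) (\<gamma>\<^sub>2 (1 / 2)) \<le> 1 / 2 * d (\<gamma>\<^sub>1 1) (\<gamma>\<^sub>2 1))"

end

end

theory Submission
  imports Defs "HOL-Real_Asymp.Real_Asymp"
begin

text \<open>From Alexandrov to Busemann the implication holds in every metric space: in a geodesic triangle,
  the Alexandrov inequality is used once for a median and once for the segment between two midpoints
  (\<open>alexandrov_imp_busemann\<close>).

  For the converse, a Hilbert metric that is Busemann is shown to be the metric of an ellipsoid, that is,
  of the Klein model of hyperbolic space, where the Alexandrov inequality follows from the law of cosines.
  Let \<open>g = mink p\<close> be the Minkowski functional of \<open>K - p\<close>, and split it into the even part
  \<open>F = finsler p\<close>, which is the norm of the Hilbert metric at \<open>p\<close>, and the odd part \<open>h = skew p\<close>. The body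
  is an ellipsoid if, at some \<open>p\<close>, \<open>h\<close> is linear and \<open>F\<close> is a Euclidean norm, because the boundary is
  \<open>F = 1 - h\<close>.

  Linearity of \<open>h\<close>. Straight lines through \<open>p\<close> are geodesics (\<open>shortest_geodesic_ray\<close>). Halving a triangle
  with apex \<open>p\<close> again and again, the Busemann inequality yields
  \<open>t * F (w - v) \<le> d (ray p v t) (ray p w t)\<close> (\<open>hilbert_dist_rays_ge\<close>). Both sides agree to first order in \<open>t\<close>,
  so the coefficient of \<open>t\<^sup>2\<close> on the right is nonnegative. This coefficient changes its sign under
  \<open>(v, w) \<mapsto> (- w, - v)\<close>, so it vanishes (\<open>second_order_eq\<close>). With \<open>w = v + e z\<close> and \<open>e\<close> tending to \<open>0\<close> this says
  \<open>F z * (dh\<^sub>z v - h v) = dF\<^sub>z v * (dh\<^sub>v z - h z)\<close> (\<open>skew_deriv_relation\<close>). Exchanging \<open>v\<close> and \<open>z\<close>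
  and multiplying, \<open>dh\<^sub>v z = h z\<close> unless \<open>dF\<^sub>z v * dF\<^sub>v z = F v * F z\<close>, and this is enough to make \<open>h\<close>
  linear (\<open>affine_of_tangent_relation\<close>, \<open>skew_add\<close>). Convexity provides the derivatives on each line at all but
  countably many points, so no smoothness of \<open>K\<close> has to be known beforehand.

  Euclidean norm. The derivative of \<open>skew p z\<close> in the base point \<open>p\<close>, in direction \<open>u\<close>, is that of
  \<open>(F\<^sup>2 + h\<^sup>2) / 2\<close> at \<open>z\<close> in direction \<open>u\<close> (\<open>skew_base_deriv\<close>). As \<open>skew\<close> is linear at every base point,
  this is linear in \<open>z\<close>. So \<open>F\<^sup>2\<close> is quadratic on every line (\<open>finsler_square_line\<close>), and the argument of Jordan
  and von Neumann gives an inner product.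

  Ellipsoids. The distance satisfies \<open>cosh d(x,y) = B(x,y) / sqrt (B(x,x) B(y,y))\<close> with a Lorentz form \<open>B\<close>
  (\<open>cosh_hilbert_dist\<close>). This gives the uniqueness of geodesics and Stewart's theorem
  (\<open>division_point\<close>), from which the Alexandrov inequality is a matter of real calculus
  (\<open>hyperbolic_cevian_le\<close>).\<close>

section \<open>Geodesics in metric spaces\<close>

context Metric_space
begin

lemma partition_sum_le_curve_length:
  fixes t :: "nat \<Rightarrow> real"
  assumes "t 0 = a" "t N = b" "strict_mono_on {0..N} t"
  shows "ereal (\<Sum>i=1..N. d (\<gamma> (t (i - 1))) (\<gamma> (t i))) \<le> curve_length \<gamma> a b"
  unfolding curve_length_def using assms by (intro Sup_upper) blast

lemma dist_le_curve_length:
  assumes "a < b"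
  shows "ereal (d (\<gamma> a) (\<gamma> b)) \<le> curve_length \<gamma> a b"
proof -
  have "strict_mono_on {0..1::nat} (\<lambda>i. if i = 0 then a else b)"
    using assms by (auto simp: strict_mono_on_def)
  from partition_sum_le_curve_length[OF _ _ this, of a b \<gamma>] show ?thesis by simp
qed

lemma curve_length_add_chord_le:
  assumes "b < c"
  shows "curve_length \<gamma> a b + ereal (d (\<gamma> b) (\<gamma> c)) \<le> curve_length \<gamma> a c"
proof -
  have *: "ereal (\<Sum>i=1..N. d (\<gamma> (t (i - 1))) (\<gamma> (t i))) \<le> curve_length \<gamma> a c - ereal (d (\<gamma> b) (\<gamma> c))"
    if t: "t 0 = a" "t N = b" "strict_mono_on {0..N} t" for N and t :: "nat \<Rightarrow> real"
  proof -
    define t' where "t' i = (if i \<le> N then t i else c)" for i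
    have le: "t i \<le> b" if "i \<le> N" for i
      using t that by (cases "i = N") (auto simp: strict_mono_on_def less_imp_le)
    have "strict_mono_on {0..Suc N} t'"
    proof (rule strict_mono_onI)
      fix i j assume "i \<in> {0..Suc N}" "j \<in> {0..Suc N}" "i < j"
      then show "t' i < t' j"
        using strict_mono_onD[OF t(3), of i j] le[of i] \<open>b < c\<close> by (cases "j = Suc N") (auto simp: t'_def)
    qed
    from partition_sum_le_curve_length[OF _ _ this, of a c \<gamma>]
    have "ereal (\<Sum>i=1..Suc N. d (\<gamma> (t' (i - 1))) (\<gamma> (t' i))) \<le> curve_length \<gamma> a c"
      using t by (simp add: t'_def)
    also have "(\<Sum>i=1..Suc N. d (\<gamma> (t' (i - 1))) (\<gamma> (t' i)))
       = (\<Sum>i=1..N. d (\<gamma> (t (i - 1))) (\<gamma> (t i))) + d (\<gamma> b) (\<gamma> c)"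
      using t(2) by (auto simp: t'_def intro!: sum.cong)
    finally show ?thesis
      by (simp add: ereal_le_minus)
  qed
  have "curve_length \<gamma> a b \<le> curve_length \<gamma> a c - ereal (d (\<gamma> b) (\<gamma> c))"
    unfolding curve_length_def[of \<gamma> a b] by (rule Sup_least) (use * in blast)
  then show ?thesis by (simp add: ereal_le_minus)
qed

text \<open>Chords never exceed arcs, and on a shortest geodesic the total length leaves no slack.\<close>

lemma shortest_geodesic_dist:
  assumes \<gamma>: "shortest_geodesic \<gamma>" and t: "t \<in> {0..1}"
  shows "\<gamma> t \<in> M" "d (\<gamma> 0) (\<gamma> t) = t * d (\<gamma> 0) (\<gamma> 1)" "d (\<gamma> t) (\<gamma> 1) = (1 - t) * d (\<gamma> 0) (\<gamma> 1)"
proof -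
  have M: "\<gamma> s \<in> M" if "s \<in> {0..1}" for s
    using path_image_subset_topspace[of mtopology \<gamma>] \<gamma> that
    unfolding shortest_geodesic_def by (metis Pi_mem topspace_mtopology)
  then show "\<gamma> t \<in> M" using t by simp
  let ?D = "d (\<gamma> 0) (\<gamma> 1)"
  have len: "curve_length \<gamma> 0 t = ereal (t * ?D)" and len1: "curve_length \<gamma> 0 1 = ereal ?D"
    using \<gamma> t by (auto simp: shortest_geodesic_def)
  have M01: "\<gamma> 0 \<in> M" "\<gamma> 1 \<in> M" using M by auto
  have "d (\<gamma> 0) (\<gamma> t) = t * ?D \<and> d (\<gamma> t) (\<gamma> 1) = (1 - t) * ?D"
  proof (cases "t = 0 \<or> t = 1")
    case True
    then show ?thesis using M01 by auto
  next
    case False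
    with t have t': "0 < t" "t < 1" by auto
    have "d (\<gamma> 0) (\<gamma> t) \<le> t * ?D"
      using dist_le_curve_length[OF t'(1), of \<gamma>] len by simp
    moreover have "t * ?D + d (\<gamma> t) (\<gamma> 1) \<le> ?D"
      using curve_length_add_chord_le[OF t'(2), of \<gamma> 0] len len1 by simp
    moreover have "?D \<le> d (\<gamma> 0) (\<gamma> t) + d (\<gamma> t) (\<gamma> 1)"
      using M01 \<open>\<gamma> t \<in> M\<close> by (intro triangle)
    ultimately show ?thesis by (auto simp: algebra_simps)
  qed
  then show "d (\<gamma> 0) (\<gamma> t) = t * ?D" "d (\<gamma> t) (\<gamma> 1) = (1 - t) * ?D" by auto
qed

lemma shortest_geodesicI:
  assumes M: "\<And>s. s \<in> {0..1} \<Longrightarrow> \<gamma> s \<in> M"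
    and dist: "\<And>s t. 0 \<le> s \<Longrightarrow> s \<le> t \<Longrightarrow> t \<le> 1 \<Longrightarrow> d (\<gamma> s) (\<gamma> t) = (t - s) * D"
  shows "shortest_geodesic \<gamma>"
proof -
  have D: "D = d (\<gamma> 0) (\<gamma> 1)" using dist[of 0 1] by simp
  have len: "curve_length \<gamma> 0 t = ereal (t * D)" if t: "t \<in> {0..1}" for t
  proof -
    have sum: "(\<Sum>i=1..N. d (\<gamma> (r (i - 1))) (\<gamma> (r i))) = t * D"
      if r: "r 0 = 0" "r N = t" "strict_mono_on {0..N} r" for N and r :: "nat \<Rightarrow> real"
    proof -
      have mono: "r i \<le> r j" if "i \<le> j" "j \<le> N" for i j
        using r(3) that by (cases "i = j") (auto simp: strict_mono_on_def less_imp_le)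
      have "(\<Sum>i=1..N. d (\<gamma> (r (i - 1))) (\<gamma> (r i))) = (\<Sum>i=1..N. (r i - r (i - 1)) * D)"
      proof (rule sum.cong[OF refl])
        fix i assume i: "i \<in> {1..N}"
        have "r 0 \<le> r (i - 1)" "r (i - 1) \<le> r i" "r i \<le> r N"
          using i by (auto intro!: mono)
        then show "d (\<gamma> (r (i - 1))) (\<gamma> (r i)) = (r i - r (i - 1)) * D"
          using r t by (intro dist) auto
      qed
      also have "\<dots> = (\<Sum>i=1..N. r i - r (i - 1)) * D" by (simp add: sum_distrib_right)
      also have "(\<Sum>i=1..N. r i - r (i - 1)) = r N - r 0"
        by (induction N) auto
      finally show ?thesis using r by simp
    qed
    have "\<exists>(N::nat) r. r 0 = 0 \<and> r N = t \<and> strict_mono_on {0..N} r"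
    proof (cases "t = 0")
      case True
      then show ?thesis by (intro exI[of _ 0] exI[of _ "\<lambda>_. 0"]) (auto intro!: strict_mono_onI)
    next
      case False
      then show ?thesis using t
        by (intro exI[of _ 1] exI[of _ "\<lambda>i. if i = 0 then 0 else t"]) (auto simp: strict_mono_on_def)
    qed
    then obtain N and r :: "nat \<Rightarrow> real" where r: "r 0 = 0" "r N = t" "strict_mono_on {0..N} r"
      by blast
    have "curve_length \<gamma> 0 t \<le> ereal (t * D)"
      unfolding curve_length_def
    proof (rule Sup_least, elim CollectE exE conjE)
      fix l N and r :: "nat \<Rightarrow> real"
      assume l: "l = ereal (\<Sum>i=1..N. d (\<gamma> (r (i - 1))) (\<gamma> (r i)))"
        and r: "r 0 = 0" "r N = t" "strict_mono_on {0..N} r"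
      show "l \<le> ereal (t * D)" unfolding l sum[OF r] ..
    qed
    moreover have "ereal (t * D) \<le> curve_length \<gamma> 0 t"
      using partition_sum_le_curve_length[OF r, of \<gamma>] sum[OF r] by simp
    ultimately show ?thesis by (rule antisym)
  qed
  have "0 \<le> D" unfolding D by simp
  have dist': "d (\<gamma> s) (\<gamma> t) \<le> \<bar>t - s\<bar> * D" if "s \<in> {0..1}" "t \<in> {0..1}" for s t
  proof (cases "s \<le> t")
    case True
    then show ?thesis using dist[of s t] that by simp
  next
    case False
    then show ?thesis using dist[of t s] that by (simp add: commute[of "\<gamma> s"])
  qed
  have "pathin mtopology \<gamma>"
    unfolding pathin_def continuous_map_to_metric
  proof (intro ballI allI impI)
    fix s \<epsilon> :: real assume s: "s \<in> topspace (top_of_set {0..1})" and "0 < \<epsilon>"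
    then have s01: "s \<in> {0..1}" by auto
    define \<delta> where "\<delta> = \<epsilon> / (D + 1)"
    have "0 < \<delta>" using \<open>0 < \<epsilon>\<close> \<open>0 \<le> D\<close> by (simp add: \<delta>_def)
    have "\<gamma> t \<in> mball (\<gamma> s) \<epsilon>" if "t \<in> {0..1}" "dist s t < \<delta>" for t
    proof -
      have "d (\<gamma> s) (\<gamma> t) \<le> \<bar>t - s\<bar> * D" using dist' s01 that by simp
      also have "\<dots> \<le> \<bar>t - s\<bar> * (D + 1)" by (intro mult_left_mono) auto
      also have "\<dots> < \<delta> * (D + 1)"
        using that(2) \<open>0 \<le> D\<close> by (intro mult_strict_right_mono) (auto simp: dist_real_def)
      also have "\<dots> = \<epsilon>" using \<open>0 \<le> D\<close> by (simp add: \<delta>_def)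
      finally show ?thesis using M s01 that by simp
    qed
    then show "\<exists>U. openin (top_of_set {0..1}) U \<and> s \<in> U \<and> (\<forall>y\<in>U. \<gamma> y \<in> mball (\<gamma> s) \<epsilon>)"
      using s01 \<open>0 < \<delta>\<close>
      by (intro exI[of _ "{0..1} \<inter> ball s \<delta>"]) (auto simp: openin_open_Int)
  qed
  moreover have "curve_length \<gamma> 0 1 = ereal D" using len[of 1] by simp
  ultimately show ?thesis
    unfolding shortest_geodesic_def using len D by auto
qed

text \<open>One application of the Alexandrov inequality bounds the median from \<open>y\<close>, a second one the
  distance of the two midpoints; all terms but the base cancel.\<close>

lemma alexandrov_imp_busemann:
  assumes "alexandrov_npc_space"
  shows "busemann_npc_space"
proof -
  have "\<exists>\<delta>>0. \<forall>\<gamma>\<^sub>1 \<gamma>\<^sub>2.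
        shortest_geodesic \<gamma>\<^sub>1 \<and> shortest_geodesic \<gamma>\<^sub>2 \<and>
        \<gamma>\<^sub>1 0 = \<gamma>\<^sub>2 0 \<and> \<gamma>\<^sub>1 0 \<in> mball p \<delta> \<and> \<gamma>\<^sub>1 1 \<in> mball p \<delta> \<and> \<gamma>\<^sub>2 1 \<in> mball p \<delta> \<longrightarrow>
          d (\<gamma>\<^sub>1 (1 / 2)) (\<gamma>\<^sub>2 (1 / 2)) \<le> 1 / 2 * d (\<gamma>\<^sub>1 1) (\<gamma>\<^sub>2 1)" if "p \<in> M" for p
  proof -
    obtain \<delta> where "0 < \<delta> \<and> (\<forall>x\<in>mball p \<delta>. \<forall>y\<in>mball p \<delta>. \<forall>z\<in>mball p \<delta>.
        \<forall>\<gamma>. shortest_geodesic \<gamma> \<and> \<gamma> 0 = x \<and> \<gamma> 1 = z \<longrightarrow>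
          (\<forall>t\<in>{0..1}. (d y (\<gamma> t))\<^sup>2 \<le>
             (1 - t) * (d y x)\<^sup>2 + t * (d y z)\<^sup>2 - t * (1 - t) * (d x z)\<^sup>2))"
      using bspec[OF conjunct2[OF assms[unfolded alexandrov_npc_space_def]] \<open>p \<in> M\<close>] ..
    then have "\<delta> > 0" and npc: "\<And>x y z \<gamma> t. \<lbrakk>x \<in> mball p \<delta>; y \<in> mball p \<delta>; z \<in> mball p \<delta>;
        shortest_geodesic \<gamma>; \<gamma> 0 = x; \<gamma> 1 = z; t \<in> {0..1}\<rbrakk> \<Longrightarrow> (d y (\<gamma> t))\<^sup>2 \<le>
             (1 - t) * (d y x)\<^sup>2 + t * (d y z)\<^sup>2 - t * (1 - t) * (d x z)\<^sup>2"
      by simp_all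
    have "d (\<gamma>\<^sub>1 (1 / 2)) (\<gamma>\<^sub>2 (1 / 2)) \<le> 1 / 2 * d (\<gamma>\<^sub>1 1) (\<gamma>\<^sub>2 1)"
      if geo: "shortest_geodesic \<gamma>\<^sub>1" "shortest_geodesic \<gamma>\<^sub>2" and eq: "\<gamma>\<^sub>1 0 = \<gamma>\<^sub>2 0"
        and ball: "\<gamma>\<^sub>1 0 \<in> mball p (\<delta> / 2)" "\<gamma>\<^sub>1 1 \<in> mball p (\<delta> / 2)" "\<gamma>\<^sub>2 1 \<in> mball p (\<delta> / 2)"
      for \<gamma>\<^sub>1 \<gamma>\<^sub>2
    proof -
      let ?o = "\<gamma>\<^sub>1 0" and ?x = "\<gamma>\<^sub>1 1" and ?y = "\<gamma>\<^sub>2 1" and ?m = "\<gamma>\<^sub>1 (1/2)" and ?n = "\<gamma>\<^sub>2 (1/2)"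
      note M = shortest_geodesic_dist(1)[OF geo(1), of "1/2"] shortest_geodesic_dist(1)[OF geo(2), of "1/2"]
      have om: "d ?o ?m = d ?o ?x / 2" using shortest_geodesic_dist(2)[OF geo(1), of "1/2"] by simp
      \<comment> \<open>The radius is halved because the midpoint may leave the ball that contains the vertices.\<close>
      have "d p ?m < \<delta>"
        using triangle[of p ?o ?m] triangle[of ?o p ?x] ball \<open>p \<in> M\<close> M om by (simp add: commute[of ?o p])
      then have m: "?m \<in> mball p \<delta>" using M \<open>p \<in> M\<close> by simp
      have b: "?o \<in> mball p \<delta>" "?x \<in> mball p \<delta>" "?y \<in> mball p \<delta>"
        using ball \<open>\<delta> > 0\<close> by auto
      have "(d ?y ?m)\<^sup>2 \<le> 1/2 * (d ?y ?o)\<^sup>2 + 1/2 * (d ?y ?x)\<^sup>2 - 1/4 * (d ?o ?x)\<^sup>2"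
        using npc[OF b(1) b(3) b(2) geo(1) refl refl, of "1/2"] by simp
      moreover have "(d ?m ?n)\<^sup>2 \<le> 1/2 * (d ?m ?o)\<^sup>2 + 1/2 * (d ?m ?y)\<^sup>2 - 1/4 * (d ?o ?y)\<^sup>2"
        using npc[OF b(1) m b(3) geo(2) eq[symmetric] refl, of "1/2"] by simp
      ultimately have "(d ?m ?n)\<^sup>2 \<le> 1/4 * (d ?x ?y)\<^sup>2"
        using om by (simp add: commute[of _ ?o] commute[of ?y ?m]
            commute[of ?y ?x] power_divide field_simps)
      then have "(d ?m ?n)\<^sup>2 \<le> (1/2 * d ?x ?y)\<^sup>2" by (simp add: power2_eq_square)
      then show ?thesis by (rule power2_le_imp_le) simp
    qed
    then show ?thesis using \<open>\<delta> > 0\<close> by (intro exI[of _ "\<delta> / 2"] conjI) (simp, blast)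
  qed
  then show ?thesis
    using assms unfolding alexandrov_npc_space_def busemann_npc_space_def by blast
qed

end

section \<open>Cevians of hyperbolic triangles\<close>

lemma sinh_le_mult_cosh:
  fixes x :: real
  assumes "0 \<le> x"
  shows "sinh x \<le> x * cosh x"
proof -
  have "0 * cosh 0 - sinh 0 \<le> x * cosh x - sinh x"
  proof (rule DERIV_nonneg_imp_nondecreasing[OF assms])
    fix y :: real assume "0 \<le> y" "y \<le> x"
    then show "\<exists>l. ((\<lambda>x. x * cosh x - sinh x) has_real_derivative l) (at y) \<and> 0 \<le> l"
      by (intro exI[of _ "y * sinh y"]) (auto intro!: derivative_eq_intros)
  qed
  then show ?thesis by simp
qed

lemma sinh_mult_cosh: "sinh x * cosh y = (sinh (x + y) + sinh (x - y)) / 2" for x y :: real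
  by (simp add: sinh_add sinh_diff)

text \<open>Stewart's theorem in the hyperbolic plane, the assumption on \<open>f\<close>, bounds the length \<open>f\<close> of a cevian by
  its Euclidean value. With \<open>cosh f = W\<close> and \<open>W'' = D\<^sup>2 W\<close> one gets \<open>(f\<^sup>2)'' \<ge> 2 D\<^sup>2\<close>, because
  \<open>\<bar>f'\<bar> \<le> D\<close> (this is the triangle inequality for \<open>a\<close>, \<open>c\<close>, \<open>D\<close>) and \<open>f coth f \<ge> 1\<close>.
  If \<open>a + c = D\<close>, then \<open>f\<close> may vanish and fail to be differentiable, but it is explicit.\<close>

lemma hyperbolic_cevian_le:
  fixes a c D f t :: real
  assumes "0 \<le> a" "0 \<le> c" "0 < D" "a \<le> D + c" "c \<le> D + a" "D \<le> a + c" "0 \<le> f"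
    and t: "t \<in> {0..1}"
    and f: "sinh D * cosh f = sinh ((1 - t) * D) * cosh a + sinh (t * D) * cosh c"
  shows "f\<^sup>2 \<le> (1 - t) * a\<^sup>2 + t * c\<^sup>2 - t * (1 - t) * D\<^sup>2"
proof -
  have sD: "0 < sinh D" using \<open>0 < D\<close> by simp
  define W where "W s = (sinh ((1 - s) * D) * cosh a + sinh (s * D) * cosh c) / sinh D" for s
  \<comment> \<open>The case \<open>c = D - a\<close> of a degenerate triangle, which also bounds \<open>W\<close> from below in general.\<close>
  have line: "(sinh ((1 - s) * D) * cosh a + sinh (s * D) * cosh (D - a)) = sinh D * cosh (s * D - a)" for s
  proof -
    have e: "s * D - (D - a) = - ((1 - s) * D - a)" "D - (s * D - a) = (1 - s) * D + a"
      "s * D + (D - a) = D + (s * D - a)" by (simp_all add: algebra_simps)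
    have "(p + q) / 2 + (r + - q) / 2 = (r + p) / 2" for p q r :: real by (simp add: field_simps)
    then show ?thesis unfolding sinh_mult_cosh e sinh_minus .
  qed
  have Wt: "W t = cosh f" using sD by (simp add: W_def flip: f)
  show ?thesis
  proof (cases "D = a + c")
    case True
    then have "c = D - a" by simp
    then have "W t = cosh (t * D - a)" using line[of t] sD by (simp add: W_def)
    then have "f = \<bar>t * D - a\<bar>"
      using Wt \<open>0 \<le> f\<close> by (metis abs_of_nonneg arcosh_cosh_real cosh_real_abs abs_ge_zero)
    then show ?thesis unfolding \<open>c = D - a\<close> by (simp add: power2_eq_square algebra_simps)
  next
    case False
    then have Dac: "D < a + c" using assms by simp
    have ge: "cosh (D - a) \<le> cosh c"
    proof -
      have "\<bar>D - a\<bar> \<le> c" using assms by (simp add: abs_le_iff)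
      then show ?thesis using assms cosh_real_nonneg_le_iff[of "\<bar>D - a\<bar>" c] by simp
    qed
    have W1: "1 < W s" if s: "s \<in> {0..1}" for s
    proof -
      have le: "sinh D * cosh (s * D - a) \<le> sinh D * W s"
        unfolding line[symmetric] W_def using ge s \<open>0 < D\<close> sD by (simp add: mult_left_mono)
      show ?thesis
      proof (cases "s * D = a")
        case False
        then have "1 < cosh (s * D - a)"
          using cosh_real_nonneg_less_iff[of 0 "\<bar>s * D - a\<bar>"] by simp
        also have "\<dots> \<le> W s" using le sD by simp
        finally show ?thesis .
      next
        case True
        have "a \<le> D" using True s \<open>0 < D\<close> by (auto simp: mult_left_le_one_le)
        have "s \<noteq> 0"
        proof
          assume "s = 0"
          then have "a = 0" using True by simp
          then show False using Dac assms by simp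
        qed
        have "cosh (D - a) < cosh c"
          using cosh_real_nonneg_less_iff[of "D - a" c] \<open>a \<le> D\<close> Dac assms by simp
        then have "sinh D * cosh (s * D - a) < sinh D * W s"
          unfolding line[symmetric] W_def using s \<open>s \<noteq> 0\<close> \<open>0 < D\<close> sD by (simp add: mult_strict_left_mono)
        then show ?thesis using True sD by simp
      qed
    qed
    define W' where "W' s = D * (cosh (s * D) * cosh c - cosh ((1 - s) * D) * cosh a) / sinh D" for s
    have dW: "(W has_real_derivative W' s) (at s)" for s
      unfolding W_def[abs_def] W'_def using sD
      by (auto intro!: derivative_eq_intros simp: field_simps)
    have dW': "(W' has_real_derivative D\<^sup>2 * W s) (at s)" for s
      unfolding W_def W'_def[abs_def] using sD
      by (auto intro!: derivative_eq_intros simp: field_simps power2_eq_square)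
    \<comment> \<open>The quantity \<open>D\<^sup>2 W\<^sup>2 - W'\<^sup>2\<close> is conserved; that it is at least \<open>D\<^sup>2\<close> means \<open>\<bar>f'\<bar> \<le> D\<close>.\<close>
    have energy: "(W' s)\<^sup>2 \<le> D\<^sup>2 * ((W s)\<^sup>2 - 1)" for s
    proof -
      define B where "B = cosh c - cosh a * cosh D"
      have Ws: "W s * sinh D = cosh a * cosh (s * D) * sinh D + B * sinh (s * D)"
      proof -
        have "W s * sinh D = sinh (D - s * D) * cosh a + sinh (s * D) * cosh c"
          using sD by (simp add: W_def left_diff_distrib)
        then show ?thesis unfolding sinh_diff B_def by (simp add: algebra_simps)
      qed
      have W's: "W' s * sinh D = D * (cosh a * sinh (s * D) * sinh D + B * cosh (s * D))"
      proof -
        have "W' s * sinh D = D * (cosh (s * D) * cosh c - cosh (D - s * D) * cosh a)"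
          using sD by (simp add: W'_def left_diff_distrib)
        then show ?thesis unfolding cosh_diff B_def by (simp add: algebra_simps)
      qed
      have "cosh c \<le> cosh (D + a)" using assms by (intro cosh_real_nonneg_le_iff[THEN iffD2]) auto
      then have "B \<le> sinh a * sinh D" "- B \<le> sinh a * sinh D"
        using ge by (auto simp: B_def cosh_add cosh_diff algebra_simps)
      then have "B\<^sup>2 \<le> (sinh a * sinh D)\<^sup>2"
        by (intro power2_le_iff_abs_le[THEN iffD2]) (auto simp: abs_le_iff order_trans)
      then have B2: "B\<^sup>2 \<le> ((cosh a)\<^sup>2 - 1) * (sinh D)\<^sup>2"
        by (simp add: power_mult_distrib sinh_square_eq)
      have id: "(cosh a * C * S + B * Z)\<^sup>2 - (cosh a * Z * S + B * C)\<^sup>2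
          = ((cosh a)\<^sup>2 * S\<^sup>2 - B\<^sup>2) * (C\<^sup>2 - Z\<^sup>2)" for C Z S :: real
        by (simp add: power2_eq_square algebra_simps)
      have "D\<^sup>2 * (W s * sinh D)\<^sup>2 - (W' s * sinh D)\<^sup>2 = D\<^sup>2 * ((cosh a)\<^sup>2 * (sinh D)\<^sup>2 - B\<^sup>2)"
        unfolding Ws W's using id[of "cosh (s * D)" "sinh D" "sinh (s * D)"]
        by (simp add: power_mult_distrib cosh_square_eq flip: right_diff_distrib)
      also have "\<dots> \<ge> D\<^sup>2 * (sinh D)\<^sup>2"
        using B2 by (intro mult_left_mono) (auto simp: algebra_simps)
      finally have "(W' s)\<^sup>2 * (sinh D)\<^sup>2 \<le> (D\<^sup>2 * ((W s)\<^sup>2 - 1)) * (sinh D)\<^sup>2"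
        by (simp add: power_mult_distrib algebra_simps)
      then show ?thesis using sD by simp
    qed
    define g where "g s = (arcosh (W s))\<^sup>2 - D\<^sup>2 * s\<^sup>2" for s
    define R where "R s = sqrt ((W s)\<^sup>2 - 1)" for s
    define g' where "g' s = 2 * arcosh (W s) * (W' s / R s) - 2 * D\<^sup>2 * s" for s
    define g'' where "g'' s = 2 * (W' s / R s)\<^sup>2
        + 2 * arcosh (W s) * (D\<^sup>2 * W s / R s - (W' s)\<^sup>2 * W s / R s ^ 3) - 2 * D\<^sup>2" for s
    have R0: "0 < R s" if "s \<in> {0..1}" for s
      using W1[OF that] by (simp add: R_def one_less_power)
    have dA: "((\<lambda>s. arcosh (W s)) has_real_derivative W' s / R s) (at s)" if "s \<in> {0..1}" for s
      using DERIV_chain2[OF arcosh_real_has_field_derivative dW, of s] W1[OF that]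
      by (simp add: R_def)
    have dR: "(R has_real_derivative W s * W' s / R s) (at s)" if "s \<in> {0..1}" for s
      using R0[OF that] unfolding R_def[abs_def]
      by (auto intro!: derivative_eq_intros dW simp: field_simps)
    have "convex_on {0..1} g"
    proof (rule f''_ge0_imp_convex[where f' = g' and f'' = g''])
      show "convex {0..1::real}" by simp
      show "(g has_real_derivative g' s) (at s)" if "s \<in> {0..1}" for s
        unfolding g_def[abs_def] g'_def
        by (auto intro!: derivative_eq_intros dA that simp: field_simps power2_eq_square)
      show "(g' has_real_derivative g'' s) (at s)" if "s \<in> {0..1}" for s
        unfolding g'_def[abs_def] g''_def using R0[OF that]
        by (auto intro!: derivative_eq_intros dA dR dW' that
            simp: field_simps power2_eq_square power3_eq_cube)
      show "0 \<le> g'' s" if s: "s \<in> {0..1}" for s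
      proof -
        have R2: "(R s)\<^sup>2 = (W s)\<^sup>2 - 1" using W1[OF s] by (simp add: R_def)
        have q: "(W' s / R s)\<^sup>2 \<le> D\<^sup>2"
          using energy[of s] R0[OF s] by (simp add: power_divide divide_le_eq flip: R2)
        have "R s \<le> arcosh (W s) * W s"
          using sinh_le_mult_cosh[of "arcosh (W s)"] W1[OF s] by (simp add: sinh_arcosh_real R_def)
        then have "1 \<le> arcosh (W s) * W s / R s" using R0[OF s] by simp
        then have "1 * (D\<^sup>2 - (W' s / R s)\<^sup>2) \<le> arcosh (W s) * W s / R s * (D\<^sup>2 - (W' s / R s)\<^sup>2)"
          using q by (intro mult_right_mono) auto
        moreover have "g'' s = 2 * (W' s / R s)\<^sup>2
          + 2 * (arcosh (W s) * W s / R s * (D\<^sup>2 - (W' s / R s)\<^sup>2)) - 2 * D\<^sup>2"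
          using R0[OF s] by (simp add: g''_def field_simps power2_eq_square power3_eq_cube)
        ultimately show ?thesis by simp
      qed
    qed
    then have "g ((1 - t) * 0 + t * 1) \<le> (1 - t) * g 0 + t * g 1"
      using t convex_onD[of "{0..1}" g t 0 1] by simp
    moreover have "W 0 = cosh a" "W 1 = cosh c" using sD by (auto simp: W_def)
    ultimately show ?thesis
      using Wt assms by (simp add: g_def arcosh_cosh_real power2_eq_square algebra_simps)
  qed
qed

section \<open>The Hilbert metric in terms of Minkowski functionals\<close>

lemma nonneg_eq_if_less_iff:
  fixes a b :: real
  assumes "0 \<le> a" "0 \<le> b" "\<And>r. 0 < r \<Longrightarrow> a < r \<longleftrightarrow> b < r"
  shows "a = b"
  using assms(1,2) assms(3)[of a] assms(3)[of b] by (cases a b rule: linorder_cases) auto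

locale bounded_convex_open =
  fixes K :: "(real ^ 'n) set"
  assumes bounded: "bounded K" and convex: "convex K" and open_K: "open K"
begin

text \<open>The Minkowski functional of \<open>K - x\<close>. In general \<open>mink x (- v) \<noteq> mink x v\<close>.\<close>

definition mink :: "real ^ 'n \<Rightarrow> real ^ 'n \<Rightarrow> real" where
  "mink x v = Inf {r. 0 < r \<and> x + v /\<^sub>R r \<in> K}"

text \<open>The set of admissible \<open>r\<close> is upward closed because \<open>K\<close> is convex, and its infimum is not attained
  because \<open>K\<close> is open.\<close>

lemma mink_less_iff:
  assumes x: "x \<in> K" and r: "0 < r"
  shows "mink x v < r \<longleftrightarrow> x + v /\<^sub>R r \<in> K"
proof -
  let ?S = "{r. 0 < r \<and> x + v /\<^sub>R r \<in> K}"
  obtain e where e: "0 < e" "ball x e \<subseteq> K"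
    using open_K x open_contains_ball by blast
  define R where "R = norm v / e + 1"
  have R: "0 < R" using e by (simp add: R_def add_nonneg_pos)
  have "norm v < R * e" using e by (simp add: R_def field_simps)
  then have "norm (v /\<^sub>R R) < e" using R by (simp add: field_simps)
  then have "R \<in> ?S" using e R by (auto simp: dist_norm)
  have bdd: "bdd_below ?S" by (rule bdd_belowI[of _ 0]) auto
  have up: "s' \<in> ?S" if "s \<in> ?S" "s \<le> s'" for s s'
  proof -
    have s: "0 < s" "0 < s'" "x + v /\<^sub>R s \<in> K" using that by auto
    have "(1 - s / s') *\<^sub>R x + (s / s') *\<^sub>R (x + v /\<^sub>R s) \<in> K"
      using convex x s that(2) by (intro convexD) auto
    also have "(1 - s / s') *\<^sub>R x + (s / s') *\<^sub>R (x + v /\<^sub>R s) = x + v /\<^sub>R s'"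
      using s by (simp add: algebra_simps divide_inverse)
    finally show ?thesis using s by simp
  qed
  show ?thesis
  proof
    assume "mink x v < r"
    then obtain s where "s \<in> ?S" "s < r"
      unfolding mink_def using \<open>R \<in> ?S\<close> bdd by (subst (asm) cInf_less_iff) auto
    with up[of s r] show "x + v /\<^sub>R r \<in> K" by simp
  next
    assume "x + v /\<^sub>R r \<in> K"
    have "((\<lambda>s. x + v /\<^sub>R s) \<longlongrightarrow> x + v /\<^sub>R r) (at_left r)"
      using r by (intro tendsto_intros) auto
    then have "eventually (\<lambda>s. x + v /\<^sub>R s \<in> K) (at_left r)"
      using open_K \<open>x + v /\<^sub>R r \<in> K\<close> by (rule topological_tendstoD)
    moreover have "eventually (\<lambda>s. s \<in> {0<..<r}) (at_left r)"
      using r by (rule eventually_at_left_real)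
    ultimately have "eventually (\<lambda>s. s \<in> ?S \<and> s < r) (at_left r)"
      by eventually_elim auto
    then obtain s where "s \<in> ?S" "s < r"
      using eventually_happens trivial_limit_at_left_real by blast
    moreover have "mink x v \<le> s"
      unfolding mink_def using bdd \<open>s \<in> ?S\<close> by (rule cInf_lower[rotated])
    ultimately show "mink x v < r" by simp
  qed
qed

lemma mink_nonneg [simp]:
  assumes "x \<in> K"
  shows "0 \<le> mink x v"
proof (rule ccontr)
  assume neg: "\<not> 0 \<le> mink x v"
  then have "1 \<in> {r. 0 < r \<and> x + v /\<^sub>R r \<in> K}"
    using mink_less_iff[OF assms, of 1 v] by simp
  then have ne: "{r. 0 < r \<and> x + v /\<^sub>R r \<in> K} \<noteq> {}" by blast
  have "0 \<le> mink x v" unfolding mink_def by (rule cInf_greatest[OF ne]) auto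
  with neg show False ..
qed

lemma mink_zero [simp]: "x \<in> K \<Longrightarrow> mink x 0 = 0"
  by (rule nonneg_eq_if_less_iff) (auto simp: mink_less_iff)

lemma mink_scaleR:
  assumes "x \<in> K" "0 \<le> c"
  shows "mink x (c *\<^sub>R v) = c * mink x v"
proof (cases "c = 0")
  case False
  with assms have "0 < c" by simp
  show ?thesis
  proof (rule nonneg_eq_if_less_iff)
    fix r :: real assume r: "0 < r"
    have "(c * mink x v < r) = (mink x v < r / c)" using \<open>0 < c\<close> by (simp add: field_simps)
    then show "(mink x (c *\<^sub>R v) < r) = (c * mink x v < r)"
      using assms r \<open>0 < c\<close> by (simp add: mink_less_iff divide_inverse mult.commute)
  qed (use assms in auto)
qed (use assms in simp)

lemma mink_add_le:
  assumes x: "x \<in> K"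
  shows "mink x (v + w) \<le> mink x v + mink x w"
proof (rule field_le_epsilon)
  fix e :: real assume "0 < e"
  define r s where "r = mink x v + e / 2" and "s = mink x w + e / 2"
  have rs: "0 < r" "0 < s" using x \<open>0 < e\<close> by (auto simp: r_def s_def add_nonneg_pos)
  have "mink x v < r" "mink x w < s" using \<open>0 < e\<close> by (auto simp: r_def s_def)
  then have "x + v /\<^sub>R r \<in> K" "x + w /\<^sub>R s \<in> K" using x rs by (auto simp: mink_less_iff)
  then have "(r / (r + s)) *\<^sub>R (x + v /\<^sub>R r) + (s / (r + s)) *\<^sub>R (x + w /\<^sub>R s) \<in> K"
    using convex rs by (intro convexD) (auto simp flip: add_divide_distrib)
  also have "(r / (r + s)) *\<^sub>R (x + v /\<^sub>R r) + (s / (r + s)) *\<^sub>R (x + w /\<^sub>R s)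
      = ((r / (r + s)) + (s / (r + s))) *\<^sub>R x + (v + w) /\<^sub>R (r + s)"
  proof -
    have "(r / (r + s)) *\<^sub>R (v /\<^sub>R r) = v /\<^sub>R (r + s)" "(s / (r + s)) *\<^sub>R (w /\<^sub>R s) = w /\<^sub>R (r + s)"
      using rs by (simp_all add: divide_inverse)
    then show ?thesis
      by (simp only: scaleR_right_distrib scaleR_left_distrib) (simp add: algebra_simps)
  qed
  also have "\<dots> = x + (v + w) /\<^sub>R (r + s)" using rs by (simp flip: add_divide_distrib)
  finally have "mink x (v + w) < r + s" using x rs by (simp add: mink_less_iff)
  then show "mink x (v + w) \<le> mink x v + mink x w + e" by (simp add: r_def s_def)
qed

lemma mink_pos:
  assumes x: "x \<in> K" and v: "v \<noteq> 0"
  shows "0 < mink x v"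
proof -
  obtain b where b: "\<And>y. y \<in> K \<Longrightarrow> norm y \<le> b" using bounded by (auto simp: bounded_iff)
  define B where "B = 2 * \<bar>b\<bar> + 1"
  have B: "0 < B" by (simp add: B_def)
  have "\<not> mink x v < norm v / B"
  proof
    assume "mink x v < norm v / B"
    then have "x + v /\<^sub>R (norm v / B) \<in> K"
      using x v B by (simp add: mink_less_iff)
    then have "norm (v /\<^sub>R (norm v / B)) \<le> b + b"
      using b[of x] b[of "x + v /\<^sub>R (norm v / B)"] x norm_triangle_ineq4[of "x + v /\<^sub>R (norm v / B)" x]
      by simp
    moreover have "norm (v /\<^sub>R (norm v / B)) = B" using v B by simp
    ultimately show False unfolding B_def by linarith
  qed
  moreover have "0 < norm v / B" using v B by simp
  ultimately show ?thesis by linarith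
qed

lemma mink_eq_0_iff [simp]: "x \<in> K \<Longrightarrow> mink x v = 0 \<longleftrightarrow> v = 0"
  using mink_pos by (metis less_irrefl mink_zero)

lemma mink_diff_less_1: "x \<in> K \<Longrightarrow> mink x (y - x) < 1 \<longleftrightarrow> y \<in> K"
  by (simp add: mink_less_iff)

lemma convex_on_mink: "x \<in> K \<Longrightarrow> convex_on UNIV (mink x)"
proof (rule convex_onI)
  fix t :: real and v w
  assume "x \<in> K" "0 < t" "t < 1"
  then show "mink x ((1 - t) *\<^sub>R v + t *\<^sub>R w) \<le> (1 - t) * mink x v + t * mink x w"
    using mink_add_le[of x "(1 - t) *\<^sub>R v" "t *\<^sub>R w"] by (simp add: mink_scaleR)
qed simp

lemma isCont_mink: "x \<in> K \<Longrightarrow> isCont (mink x) v"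
  using convex_on_continuous[OF open_UNIV convex_on_mink, of x] continuous_on_eq_continuous_at[OF open_UNIV]
  by blast

lemma tendsto_mink [tendsto_intros]:
  "x \<in> K \<Longrightarrow> (f \<longlongrightarrow> l) F \<Longrightarrow> ((\<lambda>t. mink x (f t)) \<longlongrightarrow> mink x l) F"
  by (rule isCont_tendsto_compose[OF isCont_mink])

text \<open>Both conditions say that \<open>y + v / r\<close> lies in \<open>K\<close>. Hence the Minkowski functional at any point of \<open>K\<close> is
  determined by an implicit equation for the one at \<open>x\<close>.\<close>

lemma mink_rebase_less:
  assumes "x \<in> K" "y \<in> K" "0 < r"
  shows "mink y v < r \<longleftrightarrow> mink x (v + r *\<^sub>R (y - x)) < r"
  using assms by (simp add: mink_less_iff algebra_simps)

lemma mink_rebase: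
  assumes x: "x \<in> K" and y: "y \<in> K" and r: "0 < r"
  shows "mink y v = r \<longleftrightarrow> mink x (v + r *\<^sub>R (y - x)) = r"
proof -
  have *: "mink y v = r" if xy: "x \<in> K" "y \<in> K" and eq: "mink x (v + r *\<^sub>R (y - x)) = r" for x y v
  proof -
    have "mink y v \<ge> r" using mink_rebase_less[OF xy r, of v] eq by simp
    moreover have "mink y v \<le> r + e" if "0 < e" for e
    proof -
      have "mink x (v + (r + e) *\<^sub>R (y - x)) \<le> mink x (v + r *\<^sub>R (y - x)) + mink x (e *\<^sub>R (y - x))"
        using mink_add_le[OF xy(1), of "v + r *\<^sub>R (y - x)" "e *\<^sub>R (y - x)"]
        by (simp add: scaleR_left_distrib add.assoc)
      also have "\<dots> < r + e"
        using eq xy mink_diff_less_1[of x y] \<open>0 < e\<close> by (simp add: mink_scaleR)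
      finally show ?thesis using mink_rebase_less[OF xy, of "r + e" v] r that by simp
    qed
    ultimately show ?thesis by (meson antisym field_le_epsilon)
  qed
  show ?thesis
    using *[OF x y] *[OF y x, of "v + r *\<^sub>R (y - x)"] by (auto simp: algebra_simps)
qed

lemma mink_rebase_self:
  assumes "x \<in> K" "y \<in> K"
  shows "mink x (v + mink y v *\<^sub>R (y - x)) = mink y v"
  using mink_rebase[OF assms, of "mink y v" v] mink_nonneg[OF assms(2), of v] assms
  by (cases "mink y v = 0") (auto simp: less_le)

text \<open>This point is a limit of points of \<open>K\<close>, namely with the denominators \<open>s > mink x (y - x)\<close>, but not a point
  of \<open>K\<close>.\<close>

lemma hilbert_end_mink:
  assumes x: "x \<in> K" and y: "y \<in> K" and "x \<noteq> y"
  shows "hilbert_end K x y = x + (y - x) /\<^sub>R mink x (y - x)"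
proof -
  define r where "r = mink x (y - x)"
  have r: "0 < r" "r < 1" using assms by (auto simp: r_def mink_pos mink_diff_less_1)
  let ?b = "x + (y - x) /\<^sub>R r"
  have "?b \<notin> K" using mink_less_iff[OF x r(1), of "y - x"] by (simp add: r_def)
  moreover have "?b \<in> closure K"
  proof (rule Lim_in_closed_set[OF closed_closure _ trivial_limit_at_right_real])
    show "((\<lambda>s. x + (y - x) /\<^sub>R s) \<longlongrightarrow> ?b) (at_right r)"
      using r by (intro tendsto_intros) auto
    have "eventually (\<lambda>s. r < s) (at_right r)" by (rule eventually_at_right_less)
    then show "eventually (\<lambda>s. x + (y - x) /\<^sub>R s \<in> closure K) (at_right r)"
    proof eventually_elim
      case (elim s)
      then have "x + (y - x) /\<^sub>R s \<in> K"
        using mink_less_iff[OF x, of s "y - x"] r by (simp add: r_def)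
      then show ?case using closure_subset by blast
    qed
  qed
  ultimately have "?b \<in> frontier K" using open_K by (simp add: frontier_def interior_open)
  moreover have "y \<in> open_segment x ?b"
  proof -
    have "x \<noteq> ?b" using assms r by simp
    moreover have "y = (1 - r) *\<^sub>R x + r *\<^sub>R ?b" using r by (simp add: algebra_simps)
    ultimately show ?thesis unfolding in_segment using r by blast
  qed
  ultimately show ?thesis
    unfolding hilbert_end_def r_def[symmetric]
    using hilbert_end_unique[OF bounded convex open_K x y \<open>x \<noteq> y\<close>] by (intro the1_equality) auto
qed

lemma end_ratio:
  assumes x: "x \<in> K" and y: "y \<in> K" and "x \<noteq> y"
  shows "norm (x - hilbert_end K x y) / norm (y - hilbert_end K x y) = 1 / (1 - mink x (y - x))"
proof -
  define r where "r = mink x (y - x)"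
  have r: "0 < r" "r < 1" using assms by (auto simp: r_def mink_pos mink_diff_less_1)
  have "x - hilbert_end K x y = (- (1 / r)) *\<^sub>R (y - x)"
    unfolding hilbert_end_mink[OF assms] r_def[symmetric] by (simp add: divide_inverse)
  then have 1: "norm (x - hilbert_end K x y) = (1 / r) * norm (y - x)"
    using r by (simp only: norm_scaleR) simp
  have "y - hilbert_end K x y = (1 - 1 / r) *\<^sub>R (y - x)"
    unfolding hilbert_end_mink[OF assms] r_def[symmetric] by (simp add: divide_inverse algebra_simps)
  then have 2: "norm (y - hilbert_end K x y) = (1 / r - 1) * norm (y - x)"
    using r by (simp only: norm_scaleR) (simp add: abs_if)
  show ?thesis
    using r \<open>x \<noteq> y\<close> unfolding r_def[symmetric] 1 2 by (simp add: field_simps)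
qed

abbreviation dK where "dK \<equiv> hilbert_dist K"

text \<open>The two summands are the Funk distances from \<open>x\<close> to \<open>y\<close> and from \<open>y\<close> to \<open>x\<close>.\<close>

lemma hilbert_dist_mink:
  assumes x: "x \<in> K" and y: "y \<in> K"
  shows "dK x y = (- ln (1 - mink x (y - x)) - ln (1 - mink y (x - y))) / 2"
proof (cases "x = y")
  case False
  have "mink x (y - x) < 1" "mink y (x - y) < 1" using assms by (auto simp: mink_diff_less_1)
  moreover have "norm (y - hilbert_end K y x) / norm (x - hilbert_end K y x) = 1 / (1 - mink y (x - y))"
    using end_ratio[OF y x] False by auto
  moreover have "dK x y = 1 / 2 * ln (norm (y - hilbert_end K y x) / norm (x - hilbert_end K y x)
      * (norm (x - hilbert_end K x y) / norm (y - hilbert_end K x y)))"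
    using False assms by (simp add: hilbert_dist_def Let_def)
  ultimately show ?thesis
    unfolding end_ratio[OF x y False] by (simp add: ln_mult ln_div)
qed (use assms in \<open>simp add: hilbert_dist_def\<close>)

text \<open>The triangle inequality for the Funk distance, after exponentiation. The vector \<open>z - x\<close> is split so that the
  part \<open>(z - y) + \<beta> (y - x)\<close> has, by rebasing, the same value \<open>\<beta>\<close> at \<open>x\<close> as \<open>z - y\<close> has at \<open>y\<close>.\<close>

lemma one_minus_mink_mult_le:
  assumes x: "x \<in> K" and y: "y \<in> K" and z: "z \<in> K"
  shows "(1 - mink x (y - x)) * (1 - mink y (z - y)) \<le> 1 - mink x (z - x)"
proof -
  define \<alpha> \<beta> where "\<alpha> = mink x (y - x)" and "\<beta> = mink y (z - y)"
  have \<beta>: "\<beta> < 1" using y z by (simp add: \<beta>_def mink_diff_less_1)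
  have e: "z - x = ((z - y) + \<beta> *\<^sub>R (y - x)) + (1 - \<beta>) *\<^sub>R (y - x)" by (simp add: algebra_simps)
  have "mink x (z - x) \<le> mink x ((z - y) + \<beta> *\<^sub>R (y - x)) + mink x ((1 - \<beta>) *\<^sub>R (y - x))"
    by (subst e) (rule mink_add_le[OF x])
  also have "\<dots> = \<beta> + (1 - \<beta>) * \<alpha>"
    using mink_rebase_self[OF x y] x \<beta> by (simp add: mink_scaleR \<alpha>_def \<beta>_def)
  finally show ?thesis by (simp add: \<alpha>_def[symmetric] \<beta>_def[symmetric] algebra_simps)
qed

lemma Metric_space_hilbert_dist: "Metric_space K dK"
proof
  have half: "0 \<le> - ln (1 - mink x (y - x))" if "x \<in> K" "y \<in> K" for x y
    using that mink_diff_less_1[of x y] mink_nonneg[of x "y - x"] by simp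
  show comm: "dK x y = dK y x" for x y
  proof (cases "x \<in> K \<and> y \<in> K")
    case True
    then show ?thesis by (simp add: hilbert_dist_mink)
  qed (auto simp: hilbert_dist_def)
  show "0 \<le> dK x y" for x y
  proof (cases "x \<in> K \<and> y \<in> K")
    case True
    then show ?thesis using half[of x y] half[of y x] by (simp add: hilbert_dist_mink)
  qed (auto simp: hilbert_dist_def)
  show "dK x y = 0 \<longleftrightarrow> x = y" if xy: "x \<in> K" "y \<in> K" for x y
  proof
    assume "dK x y = 0"
    then have "- ln (1 - mink x (y - x)) = 0"
      using half[OF xy] half[OF xy(2,1)] xy by (simp add: hilbert_dist_mink)
    then have "mink x (y - x) = 0"
      using xy mink_diff_less_1[of x y] by simp
    then show "x = y" using xy by simp
  qed (simp add: hilbert_dist_def)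
  show "dK x z \<le> dK x y + dK y z" if K: "x \<in> K" "y \<in> K" "z \<in> K" for x y z
  proof -
    have tri: "- ln (1 - mink x (z - x)) \<le> - ln (1 - mink x (y - x)) - ln (1 - mink y (z - y))"
      if K: "x \<in> K" "y \<in> K" "z \<in> K" for x y z
    proof -
      have pos: "0 < 1 - mink x (y - x)" "0 < 1 - mink y (z - y)"
        using K mink_diff_less_1 by auto
      then have "ln ((1 - mink x (y - x)) * (1 - mink y (z - y))) \<le> ln (1 - mink x (z - x))"
        using one_minus_mink_mult_le[OF K] mult_pos_pos[OF pos] by (intro ln_mono) auto
      then show ?thesis using pos by (simp add: ln_mult)
    qed
    show ?thesis using tri[OF K] tri[OF K(3,2,1)] K by (simp add: hilbert_dist_mink field_simps)
  qed
qed

end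

section \<open>Straight lines are geodesics\<close>

lemma tanh_quotient_exp: "(1 + tanh x) / (1 - tanh x) = exp (2 * x)" for x :: real
proof -
  have "1 + tanh x = exp x / cosh x" "1 - tanh x = exp (- x) / cosh x"
    by (simp_all add: tanh_def add_divide_distrib diff_divide_distrib flip: cosh_plus_sinh cosh_minus_sinh)
  then have "(1 + tanh x) / (1 - tanh x) = exp x / exp (- x)" by simp
  also have "\<dots> = exp (2 * x)" by (simp flip: exp_diff)
  finally show ?thesis .
qed

context bounded_convex_open
begin

text \<open>The norm of the Hilbert metric at \<open>x\<close>: it gives the first-order behaviour of the distance.\<close>

definition finsler :: "real ^ 'n \<Rightarrow> real ^ 'n \<Rightarrow> real" where
  "finsler x v = (mink x v + mink x (- v)) / 2"

text \<open>The deviation of \<open>K\<close> from symmetry about \<open>x\<close>. It is linear if and only if a projective transformation fixing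
  \<open>x\<close> makes \<open>K\<close> symmetric about \<open>x\<close>: up to linear maps, such transformations add a linear functional to
  \<open>mink x\<close>.\<close>

definition skew :: "real ^ 'n \<Rightarrow> real ^ 'n \<Rightarrow> real" where
  "skew x v = (mink x v - mink x (- v)) / 2"

lemma mink_eq_finsler_skew: "mink x v = finsler x v + skew x v" "mink x (- v) = finsler x v - skew x v"
  by (simp_all add: finsler_def skew_def field_simps)

lemma finsler_minus [simp]: "finsler x (- v) = finsler x v" and skew_minus [simp]: "skew x (- v) = - skew x v"
  by (simp_all add: finsler_def skew_def field_simps)

lemma finsler_scaleR: "x \<in> K \<Longrightarrow> finsler x (c *\<^sub>R v) = \<bar>c\<bar> * finsler x v"
  using mink_scaleR[of x c v] mink_scaleR[of x c "- v"] mink_scaleR[of x "- c" v] mink_scaleR[of x "- c" "- v"]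
  by (cases "0 \<le> c") (auto simp: finsler_def algebra_simps)

lemma skew_scaleR: "x \<in> K \<Longrightarrow> skew x (c *\<^sub>R v) = c * skew x v"
  using mink_scaleR[of x c v] mink_scaleR[of x c "- v"] mink_scaleR[of x "- c" v] mink_scaleR[of x "- c" "- v"]
  by (cases "0 \<le> c") (auto simp: skew_def algebra_simps)

lemma finsler_nonneg [simp]: "x \<in> K \<Longrightarrow> 0 \<le> finsler x v"
  by (simp add: finsler_def)

lemma finsler_zero [simp]: "x \<in> K \<Longrightarrow> finsler x 0 = 0"
  by (simp add: finsler_def)

lemma finsler_pos: "x \<in> K \<Longrightarrow> v \<noteq> 0 \<Longrightarrow> 0 < finsler x v"
  using mink_pos[of x v] mink_pos[of x "- v"] by (simp add: finsler_def)

lemma abs_skew_less_finsler: "x \<in> K \<Longrightarrow> v \<noteq> 0 \<Longrightarrow> \<bar>skew x v\<bar> < finsler x v"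
  using mink_pos[of x v] mink_pos[of x "- v"] by (auto simp: mink_eq_finsler_skew abs_less_iff)

lemma finsler_add_le: "x \<in> K \<Longrightarrow> finsler x (v + w) \<le> finsler x v + finsler x w"
  using mink_add_le[of x v w] mink_add_le[of x "- v" "- w"] by (simp add: finsler_def field_simps)

lemma tendsto_finsler [tendsto_intros]:
  "x \<in> K \<Longrightarrow> (f \<longlongrightarrow> l) F \<Longrightarrow> ((\<lambda>t. finsler x (f t)) \<longlongrightarrow> finsler x l) F"
  unfolding finsler_def by (auto intro!: tendsto_eq_intros)

lemma tendsto_skew [tendsto_intros]:
  "x \<in> K \<Longrightarrow> (f \<longlongrightarrow> l) F \<Longrightarrow> ((\<lambda>t. skew x (f t)) \<longlongrightarrow> skew x l) F"
  unfolding skew_def by (auto intro!: tendsto_eq_intros)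

lemma line_in_K:
  assumes "p \<in> K" "\<tau> * mink p v < 1" "- \<tau> * mink p (- v) < 1"
  shows "p + \<tau> *\<^sub>R v \<in> K"
proof -
  have "mink p (\<tau> *\<^sub>R v) < 1"
    using assms mink_scaleR[of p \<tau> v] mink_scaleR[of p "- \<tau>" "- v"] by (cases "0 \<le> \<tau>") auto
  then show ?thesis using mink_diff_less_1[of p "p + \<tau> *\<^sub>R v"] assms by simp
qed

lemma mink_on_line:
  assumes p: "p \<in> K" and "\<tau> * mink p v < 1" "- \<tau> * mink p (- v) < 1"
  shows "mink (p + \<tau> *\<^sub>R v) v = mink p v / (1 - \<tau> * mink p v)"
proof (cases "v = 0")
  case False
  define g where "g = mink p v"
  have g: "0 < g" "0 < 1 - \<tau> * g" using False p assms by (auto simp: g_def mink_pos)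
  define r where "r = g / (1 - \<tau> * g)"
  have r: "0 < r" using g by (simp add: r_def)
  have 1: "1 + r * \<tau> = 1 / (1 - \<tau> * g)" using g by (simp add: r_def field_simps)
  have "mink p (v + r *\<^sub>R (p + \<tau> *\<^sub>R v - p)) = mink p ((1 + r * \<tau>) *\<^sub>R v)" by (simp add: algebra_simps)
  also have "\<dots> = (1 + r * \<tau>) * g"
    unfolding g_def using g p 1 by (intro mink_scaleR) (auto simp: g_def)
  also have "\<dots> = r" unfolding 1 by (simp add: r_def)
  finally show ?thesis
    using mink_rebase[OF p line_in_K[OF assms] r, of v] by (simp add: r_def g_def)
qed (use assms in simp)

lemma hilbert_dist_line:
  assumes p: "p \<in> K" and le: "\<sigma> \<le> \<tau>"
    and \<sigma>: "\<sigma> * mink p v < 1" "- \<sigma> * mink p (- v) < 1"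
    and \<tau>: "\<tau> * mink p v < 1" "- \<tau> * mink p (- v) < 1"
  shows "dK (p + \<sigma> *\<^sub>R v) (p + \<tau> *\<^sub>R v) =
    (ln ((1 + \<tau> * mink p (- v)) / (1 - \<tau> * mink p v)) - ln ((1 + \<sigma> * mink p (- v)) / (1 - \<sigma> * mink p v))) / 2"
proof -
  define g g' where "g = mink p v" and "g' = mink p (- v)"
  have pos: "0 < 1 - \<sigma> * g" "0 < 1 + \<sigma> * g'" "0 < 1 - \<tau> * g" "0 < 1 + \<tau> * g'"
    using \<sigma> \<tau> by (simp_all add: g_def g'_def)
  note K = line_in_K[OF p \<sigma>] line_in_K[OF p \<tau>]
  have "mink (p + \<sigma> *\<^sub>R v) (p + \<tau> *\<^sub>R v - (p + \<sigma> *\<^sub>R v)) = mink (p + \<sigma> *\<^sub>R v) ((\<tau> - \<sigma>) *\<^sub>R v)"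
    by (simp add: algebra_simps)
  also have "\<dots> = (\<tau> - \<sigma>) * (g / (1 - \<sigma> * g))"
    using le K mink_on_line[OF p \<sigma>] by (simp add: mink_scaleR g_def)
  finally have 1: "1 - mink (p + \<sigma> *\<^sub>R v) (p + \<tau> *\<^sub>R v - (p + \<sigma> *\<^sub>R v)) = (1 - \<tau> * g) / (1 - \<sigma> * g)"
    using pos by (simp add: field_simps)
  have "mink (p + \<tau> *\<^sub>R v) (- v) = g' / (1 + \<tau> * g')"
    using mink_on_line[of p "- \<tau>" "- v"] p \<tau> by (simp add: g'_def)
  moreover have "mink (p + \<tau> *\<^sub>R v) (p + \<sigma> *\<^sub>R v - (p + \<tau> *\<^sub>R v)) = mink (p + \<tau> *\<^sub>R v) ((\<tau> - \<sigma>) *\<^sub>R (- v))"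
    by (simp add: algebra_simps)
  ultimately have "mink (p + \<tau> *\<^sub>R v) (p + \<sigma> *\<^sub>R v - (p + \<tau> *\<^sub>R v)) = (\<tau> - \<sigma>) * (g' / (1 + \<tau> * g'))"
    using le K by (simp add: mink_scaleR del: scaleR_minus_right)
  then have 2: "1 - mink (p + \<tau> *\<^sub>R v) (p + \<sigma> *\<^sub>R v - (p + \<tau> *\<^sub>R v)) = (1 + \<sigma> * g') / (1 + \<tau> * g')"
    using pos by (simp add: field_simps)
  show ?thesis
    unfolding hilbert_dist_mink[OF K] 1 2 g_def[symmetric] g'_def[symmetric]
    using pos by (simp add: ln_div)
qed

text \<open>The parametrization by arc length, up to the factor \<open>finsler p v\<close>, comes from solving
  \<open>1/2 ln ((1 + \<tau> g(-v)) / (1 - \<tau> g(v))) = t F(v)\<close> for \<open>\<tau>\<close>, where \<open>g = mink p\<close> and \<open>F = finsler p\<close>.\<close>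

definition ray_coeff :: "real ^ 'n \<Rightarrow> real ^ 'n \<Rightarrow> real \<Rightarrow> real" where
  "ray_coeff p v t = tanh (t * finsler p v) / (finsler p v + skew p v * tanh (t * finsler p v))"

definition ray :: "real ^ 'n \<Rightarrow> real ^ 'n \<Rightarrow> real \<Rightarrow> real ^ 'n" where
  "ray p v t = p + ray_coeff p v t *\<^sub>R v"

lemma ray_coeff_bounds:
  fixes t :: real
  assumes p: "p \<in> K" and v: "v \<noteq> 0"
  defines "\<tau> \<equiv> ray_coeff p v t"
  shows "\<tau> * mink p v < 1" "- \<tau> * mink p (- v) < 1"
    and "(1 + \<tau> * mink p (- v)) / (1 - \<tau> * mink p v) = exp (2 * (t * finsler p v))"
    and "0 < finsler p v + skew p v * tanh (t * finsler p v)"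
proof -
  define F h T where "F = finsler p v" and "h = skew p v" and "T = tanh (t * F)"
  have T: "\<bar>T\<bar> < 1" using tanh_real_bounds[of "t * F"] by (auto simp: T_def abs_less_iff)
  have h: "\<bar>h\<bar> < F" using p v by (simp add: F_def h_def abs_skew_less_finsler)
  have "\<bar>h * T\<bar> \<le> \<bar>h\<bar>" using T by (simp add: abs_mult mult_left_le)
  then have D: "0 < F + h * T" using h by linarith
  then show "0 < finsler p v + skew p v * tanh (t * finsler p v)" by (simp add: F_def h_def T_def)
  have \<tau>: "\<tau> = T / (F + h * T)" by (simp add: \<tau>_def ray_coeff_def F_def h_def T_def)
  have F: "0 < F" using h by linarith
  have 1: "1 - \<tau> * mink p v = F * (1 - T) / (F + h * T)"
    using D by (simp add: \<tau> mink_eq_finsler_skew F_def[symmetric] h_def[symmetric] field_simps)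
  have 2: "1 + \<tau> * mink p (- v) = F * (1 + T) / (F + h * T)"
    using D by (simp add: \<tau> mink_eq_finsler_skew F_def[symmetric] h_def[symmetric] field_simps)
  have "0 < 1 - \<tau> * mink p v" unfolding 1 using F D T by simp
  then show "\<tau> * mink p v < 1" by simp
  have "0 < 1 + \<tau> * mink p (- v)" unfolding 2 using F D T by simp
  then show "- \<tau> * mink p (- v) < 1" by simp
  show "(1 + \<tau> * mink p (- v)) / (1 - \<tau> * mink p v) = exp (2 * (t * finsler p v))"
    unfolding 1 2 using F D by (simp add: T_def F_def flip: tanh_quotient_exp)
qed

lemma ray_in_K: "p \<in> K \<Longrightarrow> ray p v t \<in> K"
  unfolding ray_def using line_in_K ray_coeff_bounds by (cases "v = 0") auto

lemma ray_0 [simp]: "ray p v 0 = p"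
  by (simp add: ray_def ray_coeff_def)

lemma hilbert_dist_ray:
  assumes p: "p \<in> K" and "s \<le> t"
  shows "dK (ray p v s) (ray p v t) = (t - s) * finsler p v"
proof (cases "v = 0")
  case True
  interpret Metric_space K dK by (rule Metric_space_hilbert_dist)
  show ?thesis using True p by (simp add: ray_def)
next
  case False
  define F h where "F = finsler p v" and "h = skew p v"
  have "tanh (s * F) \<le> tanh (t * F)"
    using \<open>s \<le> t\<close> p by (simp add: F_def mult_right_mono)
  moreover have "0 < F + h * tanh (s * F)" "0 < F + h * tanh (t * F)" "0 < F"
    using ray_coeff_bounds(4)[OF p False] finsler_pos[OF p False] by (auto simp: F_def h_def)
  ultimately have "ray_coeff p v s \<le> ray_coeff p v t"
    by (simp add: ray_coeff_def frac_le_eq divide_le_0_iff field_simps flip: F_def h_def)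
  then show ?thesis
    unfolding ray_def
    using hilbert_dist_line[OF p _ ray_coeff_bounds(1,2)[OF p False] ray_coeff_bounds(1,2)[OF p False], of s t]
    unfolding ray_coeff_bounds(3)[OF p False] by (simp add: left_diff_distrib)
qed

lemma shortest_geodesic_ray:
  assumes p: "p \<in> K" and "0 \<le> t"
  shows "Metric_space.shortest_geodesic K dK (\<lambda>s. ray p v (s * t))"
proof -
  interpret Metric_space K dK by (rule Metric_space_hilbert_dist)
  show ?thesis
    by (rule shortest_geodesicI[where D = "t * finsler p v"])
      (use assms in \<open>auto simp: ray_in_K hilbert_dist_ray mult_right_mono algebra_simps\<close>)
qed

end

section \<open>The Busemann inequality to second order\<close>

text \<open>The second-order term of a ray: the parameter \<open>t\<close> corresponds to the affine parameter \<open>t - h t\<^sup>2 + ...\<close>.\<close>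

lemma ray_speed_expansion:
  fixes F h :: real
  assumes "0 < F"
  shows "((\<lambda>t. (tanh (t * F) / (F + h * tanh (t * F)) / t - 1) / t) \<longlongrightarrow> - h) (at_right 0)"
  using assms by real_asymp

text \<open>The right-hand side agrees with the logarithm up to and including the second order, which is what the
  expansion of the distance below needs, and it is rational.\<close>

lemma minus_ln_one_minus_le:
  fixes x :: real
  assumes "0 \<le> x" "x < 1"
  shows "- ln (1 - x) \<le> x * (1 - x / 2) / (1 - x)"
proof -
  have "0 * (1 - 0 / 2) / (1 - 0) + ln (1 - 0) \<le> x * (1 - x / 2) / (1 - x) + ln (1 - x)"
  proof (rule DERIV_nonneg_imp_nondecreasing[OF assms(1)])
    fix y assume y: "0 \<le> y" "y \<le> x"
    have "((\<lambda>x. x * (1 - x / 2)) has_real_derivative 1 - y) (at y)"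
      by (auto intro!: derivative_eq_intros)
    then have "((\<lambda>x. x * (1 - x / 2) / (1 - x) + ln (1 - x)) has_real_derivative
      ((1 - y) * (1 - y) + y * (1 - y / 2)) / (1 - y)\<^sup>2 - 1 / (1 - y)) (at y)"
      using y assms by (auto intro!: derivative_eq_intros simp: power2_eq_square)
    moreover have "((1 - y) * (1 - y) + y * (1 - y / 2)) / (1 - y)\<^sup>2 - 1 / (1 - y) = (y / (1 - y))\<^sup>2 / 2"
    proof -
      define u where "u = 1 - y"
      have "0 < u" "y = 1 - u" using y assms by (auto simp: u_def)
      then show ?thesis unfolding \<open>y = 1 - u\<close> by (simp add: field_simps power2_eq_square)
    qed
    ultimately show "\<exists>l. ((\<lambda>x. x * (1 - x / 2) / (1 - x) + ln (1 - x)) has_real_derivative l) (at y) \<and> 0 \<le> l"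
      by auto
  qed
  then show ?thesis by simp
qed

context bounded_convex_open
begin

text \<open>The factor by which \<open>ray\<close> deviates from the affine parametrization, extended continuously to \<open>t = 0\<close>.\<close>

definition ray_speed :: "real ^ 'n \<Rightarrow> real ^ 'n \<Rightarrow> real \<Rightarrow> real" where
  "ray_speed p v t = (if t = 0 then 1 else ray_coeff p v t / t)"

lemma ray_speed_0 [simp]: "ray_speed p v 0 = 1"
  by (simp add: ray_speed_def)

lemma ray_eq_speed: "ray p v t = p + (t * ray_speed p v t) *\<^sub>R v"
  by (simp add: ray_def ray_speed_def ray_coeff_def)

lemma ray_speed_deriv:
  assumes "p \<in> K" "v \<noteq> 0"
  shows "(ray_speed p v has_real_derivative - skew p v) (at_right 0)"
proof -
  have "((\<lambda>t. (ray_coeff p v t / t - 1) / t) \<longlongrightarrow> - skew p v) (at_right 0)"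
    unfolding ray_coeff_def by (rule ray_speed_expansion) (use finsler_pos assms in auto)
  then have "((\<lambda>t. (ray_speed p v t - ray_speed p v 0) / (t - 0)) \<longlongrightarrow> - skew p v) (at_right 0)"
  proof (rule Lim_transform_eventually)
    show "\<forall>\<^sub>F t in at_right 0. (ray_coeff p v t / t - 1) / t = (ray_speed p v t - ray_speed p v 0) / (t - 0)"
      using eventually_at_right_less[of 0] by eventually_elim (simp add: ray_speed_def)
  qed
  then show ?thesis by (simp add: has_field_derivative_iff)
qed

text \<open>The speed \<open>\<psi>\<close> of the chord from \<open>p + t a(t) v\<close> to \<open>p + t b(t) w\<close>, as seen from its initial point, and its right
  derivative at \<open>t = 0\<close>. The base point moves with \<open>t\<close>; rebasing to \<open>p\<close> turns this into an implicit equation for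
  \<open>\<psi>\<close>, in which only \<open>mink p\<close> occurs, and only its derivative at \<open>w - v\<close> in direction \<open>v\<close> matters.\<close>

lemma mink_chord_expansion:
  fixes a b :: "real \<Rightarrow> real" and p v w :: "real ^ 'n"
  assumes p: "p \<in> K" and ab: "a 0 = 1" "b 0 = 1"
    and a: "(a has_real_derivative a') (at_right 0)" and b: "(b has_real_derivative b') (at_right 0)"
    and K: "\<forall>\<^sub>F t in at_right 0. p + (t * a t) *\<^sub>R v \<in> K"
  defines "\<psi> \<equiv> \<lambda>t. if t = 0 then mink p (w - v)
      else mink (p + (t * a t) *\<^sub>R v) ((p + (t * b t) *\<^sub>R w) - (p + (t * a t) *\<^sub>R v)) / t"
  shows "(\<psi> \<longlongrightarrow> mink p (w - v)) (at_right 0)"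
    and "((\<lambda>s. mink p (w - v + s *\<^sub>R v)) has_real_derivative \<rho>') (at 0) \<Longrightarrow>
      (\<psi> has_real_derivative (mink p (w - v) * b' + \<rho>' * (b' - a' + mink p (w - v)))) (at_right 0)"
proof -
  define z where "z = w - v"
  have w: "w = v + z" by (simp add: z_def)
  have lim: "(a \<longlongrightarrow> 1) (at_right 0)" "(b \<longlongrightarrow> 1) (at_right 0)"
    using DERIV_continuous[OF a] DERIV_continuous[OF b] ab by (auto simp: continuous_within)
  have id0: "((\<lambda>t::real. t) \<longlongrightarrow> 0) (at_right 0)" by (rule tendsto_ident_at)
  \<comment> \<open>Seen from \<open>p\<close>, the chord speed solves an implicit equation.\<close>
  have eq: "\<forall>\<^sub>F t in at_right 0. \<psi> t = mink p (b t *\<^sub>R w - a t *\<^sub>R v + (t * \<psi> t * a t) *\<^sub>R v)"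
    using K eventually_at_right_less[of 0]
  proof eventually_elim
    case (elim t)
    define x c where "x = p + (t * a t) *\<^sub>R v" and "c = b t *\<^sub>R w - a t *\<^sub>R v"
    have x: "x \<in> K" using elim by (simp add: x_def)
    have "(p + (t * b t) *\<^sub>R w) - (p + (t * a t) *\<^sub>R v) = t *\<^sub>R c"
      by (simp add: c_def algebra_simps)
    then have \<psi>: "\<psi> t = mink x c"
      using elim x by (simp add: \<psi>_def x_def[symmetric] mink_scaleR)
    have "mink p (c + mink x c *\<^sub>R (x - p)) = mink x c"
      by (rule mink_rebase_self[OF p x])
    then show ?case by (simp add: \<psi> x_def c_def mult_ac)
  qed
  have t\<psi>: "((\<lambda>t. t * \<psi> t) \<longlongrightarrow> 0) (at_right 0)"
  proof (rule tendsto_sandwich[where f = "\<lambda>_. 0"])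
    let ?u = "\<lambda>t. t * (mink p (b t *\<^sub>R w - a t *\<^sub>R v) / (1 - t * (a t * mink p v)))"
    show "(?u \<longlongrightarrow> 0) (at_right 0)"
      using p by (auto intro!: tendsto_eq_intros lim id0)
    have "((\<lambda>t. t * (a t * mink p v)) \<longlongrightarrow> 0) (at_right 0)"
      by (auto intro!: tendsto_eq_intros lim id0)
    then have "\<forall>\<^sub>F t in at_right 0. t * (a t * mink p v) < 1"
      by (rule order_tendstoD) simp
    moreover have "\<forall>\<^sub>F t in at_right 0. 0 < a t" using lim(1) by (rule order_tendstoD) simp
    ultimately show "\<forall>\<^sub>F t in at_right 0. t * \<psi> t \<le> ?u t"
      using eventually_at_right_less[of 0] eq
    proof eventually_elim
      case (elim t)
      have "0 \<le> \<psi> t" using elim(4) mink_nonneg[OF p] by metis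
      have "\<psi> t \<le> mink p (b t *\<^sub>R w - a t *\<^sub>R v) + mink p ((t * \<psi> t * a t) *\<^sub>R v)"
        using elim(4) mink_add_le[OF p, of "b t *\<^sub>R w - a t *\<^sub>R v" "(t * \<psi> t * a t) *\<^sub>R v"] by simp
      also have "mink p ((t * \<psi> t * a t) *\<^sub>R v) = t * \<psi> t * a t * mink p v"
        using elim \<open>0 \<le> \<psi> t\<close> p by (intro mink_scaleR) auto
      finally have "\<psi> t * (1 - t * (a t * mink p v)) \<le> mink p (b t *\<^sub>R w - a t *\<^sub>R v)"
        by (simp add: algebra_simps)
      then have "\<psi> t \<le> mink p (b t *\<^sub>R w - a t *\<^sub>R v) / (1 - t * (a t * mink p v))"
        using elim by (simp add: pos_le_divide_eq)
      then show ?case using elim by (intro mult_left_mono) auto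
    qed
    show "\<forall>\<^sub>F t in at_right 0. 0 \<le> t * \<psi> t"
      using eq eventually_at_right_less[of 0]
    proof eventually_elim
      case (elim t)
      then show ?case using mink_nonneg[OF p] by (metis less_imp_le mult_nonneg_nonneg)
    qed
  qed simp
  have "((\<lambda>t. b t *\<^sub>R w - a t *\<^sub>R v + (t * \<psi> t * a t) *\<^sub>R v) \<longlongrightarrow>
      1 *\<^sub>R w - 1 *\<^sub>R v + (0 * 1) *\<^sub>R v) (at_right 0)"
    by (intro tendsto_add tendsto_diff tendsto_scaleR tendsto_const lim tendsto_mult[OF t\<psi> lim(1)])
  from tendsto_mink[OF p this]
  have "((\<lambda>t. mink p (b t *\<^sub>R w - a t *\<^sub>R v + (t * \<psi> t * a t) *\<^sub>R v)) \<longlongrightarrow> mink p (w - v)) (at_right 0)"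
    by simp
  then show \<psi>lim: "(\<psi> \<longlongrightarrow> mink p (w - v)) (at_right 0)"
    by (rule Lim_transform_eventually) (use eq in \<open>auto elim!: eventually_mono\<close>)
  assume \<rho>': "((\<lambda>s. mink p (w - v + s *\<^sub>R v)) has_real_derivative \<rho>') (at 0)"
  define \<rho> where "\<rho> s = mink p (z + s *\<^sub>R v)" for s
  have \<rho>: "(\<rho> has_real_derivative \<rho>') (at 0)" "\<rho> 0 = mink p z" using \<rho>' by (simp_all add: \<rho>_def[abs_def] z_def)
  \<comment> \<open>In terms of \<open>v\<close> and \<open>z\<close> the argument of \<open>mink p\<close> is \<open>A v + b z\<close>, with \<open>A\<close> vanishing at \<open>0\<close>.\<close>
  define A where "A t = b t - a t + t * \<psi> t * a t" for t
  have A0: "A 0 = 0" by (simp add: A_def ab)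
  have "((\<lambda>t. \<psi> t * a t) \<longlongrightarrow> mink p z) (at_right 0)"
    using tendsto_mult[OF \<psi>lim lim(1)] by (simp add: z_def)
  then have "((\<lambda>t. (t * \<psi> t * a t - 0) / (t - 0)) \<longlongrightarrow> mink p z) (at_right 0)"
  proof (rule Lim_transform_eventually)
    show "\<forall>\<^sub>F t in at_right 0. \<psi> t * a t = (t * \<psi> t * a t - 0) / (t - 0)"
      using eventually_at_right_less[of 0] by eventually_elim simp
  qed
  then have "((\<lambda>t. t * \<psi> t * a t) has_real_derivative mink p z) (at_right 0)"
    by (simp add: has_field_derivative_iff)
  then have dA: "(A has_real_derivative b' - a' + mink p z) (at_right 0)"
    unfolding A_def[abs_def] by (intro DERIV_add DERIV_diff a b)
  have dAb: "((\<lambda>t. A t / b t) has_real_derivative b' - a' + mink p z) (at_right 0)"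
    using DERIV_divide[OF dA b] by (simp add: ab A0)
  have "((\<lambda>t. \<rho> (A t / b t)) has_real_derivative \<rho>' * (b' - a' + mink p z)) (at_right 0)"
    using DERIV_chain2[OF _ dAb, of \<rho> \<rho>'] \<rho>(1) by (simp add: A0)
  from DERIV_mult[OF b this]
  have d: "((\<lambda>t. b t * \<rho> (A t / b t)) has_real_derivative (mink p z * b' + \<rho>' * (b' - a' + mink p z))) (at_right 0)"
    using \<rho>(2) by (simp add: ab A0 algebra_simps)
  have "\<forall>\<^sub>F t in at_right 0. 0 < b t" using lim(2) by (rule order_tendstoD) simp
  then have ev: "\<forall>\<^sub>F t in at_right 0. b t * \<rho> (A t / b t) = \<psi> t"
    using eq
  proof eventually_elim
    case (elim t)
    have "b t * \<rho> (A t / b t) = mink p (b t *\<^sub>R (z + (A t / b t) *\<^sub>R v))"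
      unfolding \<rho>_def using elim p by (intro mink_scaleR[symmetric]) auto
    also have "b t *\<^sub>R (z + (A t / b t) *\<^sub>R v) = b t *\<^sub>R z + A t *\<^sub>R v"
      using elim by (simp add: scaleR_right_distrib)
    also have "\<dots> = b t *\<^sub>R w - a t *\<^sub>R v + (t * \<psi> t * a t) *\<^sub>R v"
      by (simp add: A_def w algebra_simps)
    finally show ?case using elim by simp
  qed
  show "(\<psi> has_real_derivative (mink p (w - v) * b' + \<rho>' * (b' - a' + mink p (w - v)))) (at_right 0)"
  proof -
    have \<psi>_0: "\<psi> 0 = mink p z" by (simp add: \<psi>_def z_def)
    have "((\<lambda>t. (b t * \<rho> (A t / b t) - mink p z) / t) \<longlongrightarrow>
        mink p z * b' + \<rho>' * (b' - a' + mink p z)) (at_right 0)"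
      using d by (simp add: has_field_derivative_iff ab A0 \<rho>(2))
    then have "((\<lambda>t. (\<psi> t - \<psi> 0) / (t - 0)) \<longlongrightarrow>
        mink p z * b' + \<rho>' * (b' - a' + mink p z)) (at_right 0)"
      by (rule Lim_transform_eventually) (use ev in \<open>auto elim!: eventually_mono simp: \<psi>_0\<close>)
    then show ?thesis by (simp add: has_field_derivative_iff z_def)
  qed
qed

text \<open>By halving, the Busemann inequality propagates to the infinitesimal scale, where the
  distance of two rays is given by \<open>finsler p\<close>.\<close>

lemma hilbert_dist_rays_ge:
  assumes p: "p \<in> K" and t: "0 \<le> t" "t * finsler p v < \<delta>" "t * finsler p w < \<delta>" and vw: "v \<noteq> 0" "w \<noteq> 0"
    and npc: "\<And>\<gamma> \<gamma>'. \<lbrakk>Metric_space.shortest_geodesic K dK \<gamma>; Metric_space.shortest_geodesic K dK \<gamma>';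
        \<gamma> 0 = p; \<gamma>' 0 = p; dK p (\<gamma> 1) < \<delta>; dK p (\<gamma>' 1) < \<delta>\<rbrakk>
        \<Longrightarrow> dK (\<gamma> (1 / 2)) (\<gamma>' (1 / 2)) \<le> 1 / 2 * dK (\<gamma> 1) (\<gamma>' 1)"
  shows "t * finsler p (w - v) \<le> dK (ray p v t) (ray p w t)"
proof (cases "t = 0")
  case True
  then show ?thesis by (simp add: hilbert_dist_def)
next
  case False
  with t have t0: "0 < t" by simp
  define f where "f s = dK (ray p v s) (ray p w s)" for s
  have from_p: "dK p (ray p u s) = s * finsler p u" if "0 \<le> s" for s u
    using hilbert_dist_ray[OF p that, of u] by simp
  have half: "2 * f (s / 2) \<le> f s" if s: "0 \<le> s" "s \<le> t" for s
  proof -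
    have "s * finsler p u \<le> t * finsler p u" for u using s p by (intro mult_right_mono) auto
    then have "s * finsler p v < \<delta>" "s * finsler p w < \<delta>" using t by (meson le_less_trans)+
    then show ?thesis
      using npc[OF shortest_geodesic_ray[OF p s(1), of v] shortest_geodesic_ray[OF p s(1), of w]] from_p[OF s(1)]
      by (simp add: f_def)
  qed
  have f_ge: "2 ^ k * f (t / 2 ^ k) \<le> f t" for k
  proof (induction k)
    case (Suc k)
    have "t / 2 ^ k \<le> t" using t0 by (simp add: divide_le_eq mult_le_cancel_left1)
    then have "2 ^ k * (2 * f (t / 2 ^ k / 2)) \<le> 2 ^ k * f (t / 2 ^ k)"
      using half[of "t / 2 ^ k"] t0 by (intro mult_left_mono) auto
    also note Suc
    finally show ?case by (simp add: mult_ac)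
  qed simp
  define \<psi> where "\<psi> v w t = (if t = 0 then mink p (w - v) else mink (ray p v t) (ray p w t - ray p v t) / t)" for v w t
  have lim: "(\<psi> v w \<longlongrightarrow> mink p (w - v)) (at_right 0)" if "v \<noteq> 0" "w \<noteq> 0" for v w
    unfolding \<psi>_def[abs_def] ray_eq_speed
    by (rule mink_chord_expansion(1)[OF p _ _ ray_speed_deriv ray_speed_deriv])
      (use p that ray_in_K[OF p, of v] in \<open>auto simp: ray_eq_speed\<close>)
  have f_ge': "s * ((\<psi> v w s + \<psi> w v s) / 2) \<le> f s" if "0 < s" for s
  proof -
    have le: "x \<le> - ln (1 - x)" if "x < 1" for x :: real
      using ln_add_one_self_le_self2[of "- x"] that by simp
    have "mink (ray p v s) (ray p w s - ray p v s) < 1" "mink (ray p w s) (ray p v s - ray p w s) < 1"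
      using p by (simp_all add: mink_diff_less_1 ray_in_K)
    note b = this[THEN le]
    have "s * ((\<psi> v w s + \<psi> w v s) / 2)
        = (mink (ray p v s) (ray p w s - ray p v s) + mink (ray p w s) (ray p v s - ray p w s)) / 2"
      using that by (simp add: \<psi>_def field_simps)
    also have "\<dots> \<le> (- ln (1 - mink (ray p v s) (ray p w s - ray p v s))
        - ln (1 - mink (ray p w s) (ray p v s - ray p w s))) / 2"
      using b by (intro divide_right_mono) linarith+
    also have "\<dots> = f s"
      unfolding f_def using p by (intro hilbert_dist_mink[symmetric] ray_in_K)
    finally show ?thesis .
  qed
  have seq: "filterlim (\<lambda>k::nat. t / 2 ^ k) (at_right 0) sequentially"
    using t0 by real_asymp
  have "((\<lambda>s. (\<psi> v w s + \<psi> w v s) / 2) \<longlongrightarrow> (mink p (w - v) + mink p (v - w)) / 2) (at_right 0)"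
    using vw by (intro tendsto_intros lim) auto
  also have "(mink p (w - v) + mink p (v - w)) / 2 = finsler p (w - v)" by (simp add: finsler_def)
  finally have "(\<lambda>k::nat. t * ((\<psi> v w (t / 2 ^ k) + \<psi> w v (t / 2 ^ k)) / 2)) \<longlonglongrightarrow> t * finsler p (w - v)"
    by (intro tendsto_mult_left) (rule filterlim_compose[OF _ seq])
  moreover have "t * ((\<psi> v w (t / 2 ^ k) + \<psi> w v (t / 2 ^ k)) / 2) \<le> f t" for k :: nat
  proof -
    have "2 ^ k * (t / 2 ^ k * ((\<psi> v w (t / 2 ^ k) + \<psi> w v (t / 2 ^ k)) / 2)) \<le> 2 ^ k * f (t / 2 ^ k)"
      using t0 by (intro mult_left_mono f_ge') auto
    also note f_ge[of k]
    finally show ?thesis by simp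
  qed
  ultimately show ?thesis unfolding f_def[symmetric] by (intro LIMSEQ_le_const2) auto
qed

end

lemma right_deriv_nonneg:
  fixes f :: "real \<Rightarrow> real"
  assumes "(f has_real_derivative D) (at_right 0)" and "\<forall>\<^sub>F t in at_right 0. f 0 \<le> f t"
  shows "0 \<le> D"
proof (rule tendsto_lowerbound)
  show "((\<lambda>t. (f t - f 0) / (t - 0)) \<longlongrightarrow> D) (at_right 0)"
    using assms(1) by (simp add: has_field_derivative_iff)
  show "\<forall>\<^sub>F t in at_right 0. 0 \<le> (f t - f 0) / (t - 0)"
    using assms(2) eventually_at_right_less[of 0] by eventually_elim simp
qed simp

context bounded_convex_open
begin

text \<open>The trace that the Busemann inequality leaves at \<open>p\<close>: small triangles with apex \<open>p\<close> are at least as wide as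
  in the tangent space with the norm \<open>finsler p\<close>.\<close>

definition rays_diverge :: "real ^ 'n \<Rightarrow> bool" where
  "rays_diverge p \<longleftrightarrow> (\<exists>\<delta>>0. \<forall>v w t. v \<noteq> 0 \<longrightarrow> w \<noteq> 0 \<longrightarrow> 0 \<le> t \<longrightarrow> t * finsler p v < \<delta> \<longrightarrow> t * finsler p w < \<delta> \<longrightarrow>
     t * finsler p (w - v) \<le> dK (ray p v t) (ray p w t))"

text \<open>Along \<open>u\<close> itself, homogeneity gives the derivative \<open>mink p u\<close>. So one directional derivative that
  exists in a transversal direction \<open>v\<close> determines those in all directions of the plane.\<close>

lemma mink_deriv_comb:
  assumes p: "p \<in> K" and d: "((\<lambda>s. mink p (u + s *\<^sub>R v)) has_real_derivative d) (at 0)"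
  shows "((\<lambda>s. mink p (u + s *\<^sub>R (\<alpha> *\<^sub>R u + \<beta> *\<^sub>R v))) has_real_derivative \<alpha> * mink p u + \<beta> * d) (at 0)"
proof -
  define \<rho> where "\<rho> s = mink p (u + s *\<^sub>R v)" for s
  have "((\<lambda>s. (\<beta> * s) / (1 + \<alpha> * s)) has_real_derivative \<beta>) (at 0)"
    by (auto intro!: derivative_eq_intros)
  then have "((\<lambda>s. \<rho> ((\<beta> * s) / (1 + \<alpha> * s))) has_real_derivative d * \<beta>) (at 0)"
    by (intro DERIV_chain2[of \<rho>]) (use d in \<open>simp_all add: \<rho>_def[abs_def]\<close>)
  then have "((\<lambda>s. (1 + \<alpha> * s) * \<rho> ((\<beta> * s) / (1 + \<alpha> * s))) has_real_derivative \<alpha> * mink p u + \<beta> * d) (at 0)"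
    by (auto intro!: derivative_eq_intros simp: \<rho>_def)
  moreover have "\<forall>\<^sub>F s in nhds 0. mink p (u + s *\<^sub>R (\<alpha> *\<^sub>R u + \<beta> *\<^sub>R v)) = (1 + \<alpha> * s) * \<rho> ((\<beta> * s) / (1 + \<alpha> * s))"
  proof -
    have "((\<lambda>s. 1 + \<alpha> * s) \<longlongrightarrow> 1) (nhds 0)"
      by (auto intro!: tendsto_eq_intros simp: filterlim_ident)
    then have "\<forall>\<^sub>F s in nhds 0. 0 < 1 + \<alpha> * s" by (rule order_tendstoD) simp
    then show ?thesis
    proof eventually_elim
      case (elim s)
      then have "(1 + \<alpha> * s) * \<rho> ((\<beta> * s) / (1 + \<alpha> * s)) = mink p ((1 + \<alpha> * s) *\<^sub>R (u + ((\<beta> * s) / (1 + \<alpha> * s)) *\<^sub>R v))"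
        unfolding \<rho>_def using p by (intro mink_scaleR[symmetric]) auto
      also have "(1 + \<alpha> * s) *\<^sub>R (u + ((\<beta> * s) / (1 + \<alpha> * s)) *\<^sub>R v) = (1 + \<alpha> * s) *\<^sub>R u + (\<beta> * s) *\<^sub>R v"
        using elim by (simp add: scaleR_right_distrib)
      also have "\<dots> = u + s *\<^sub>R (\<alpha> *\<^sub>R u + \<beta> *\<^sub>R v)" by (simp add: algebra_simps)
      finally show ?case ..
    qed
  qed
  ultimately show ?thesis by (subst DERIV_cong_ev[OF refl _ refl])
qed

lemma mink_deriv_scale:
  assumes p: "p \<in> K" and d: "((\<lambda>s. mink p (u + s *\<^sub>R v)) has_real_derivative d) (at 0)" and e: "0 < e"
  shows "((\<lambda>s. mink p (e *\<^sub>R u + s *\<^sub>R v)) has_real_derivative d) (at 0)"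
proof -
  have [simp]: "e \<noteq> 0" using e by simp
  have eq: "mink p (e *\<^sub>R u + s *\<^sub>R v) = e * mink p (u + (s / e) *\<^sub>R v)" for s
  proof -
    have "e * mink p (u + (s / e) *\<^sub>R v) = mink p (e *\<^sub>R (u + (s / e) *\<^sub>R v))"
      using p e by (intro mink_scaleR[symmetric]) auto
    also have "e *\<^sub>R (u + (s / e) *\<^sub>R v) = e *\<^sub>R u + s *\<^sub>R v"
      using e by (simp add: scaleR_right_distrib)
    finally show ?thesis ..
  qed
  have "((\<lambda>s. s / e) has_real_derivative 1 / e) (at 0)"
    by (auto intro!: derivative_eq_intros)
  then have "((\<lambda>s. mink p (u + (s / e) *\<^sub>R v)) has_real_derivative d * (1 / e)) (at 0)"
    by (intro DERIV_chain2[of "\<lambda>s. mink p (u + s *\<^sub>R v)"]) (use d in simp_all)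
  then have "((\<lambda>s. e * mink p (u + (s / e) *\<^sub>R v)) has_real_derivative e * (d * (1 / e))) (at 0)"
    by (rule DERIV_cmult)
  then show ?thesis using e by (simp add: eq)
qed

text \<open>The distance of two rays divided by \<open>t\<close> is at least its limit at \<open>0\<close>, so its right derivative there, the
  expression below, is nonnegative.
  Here \<open>(fp - fm) / 2\<close> and \<open>(fp + fm) / 2\<close> are the derivatives of \<open>finsler p\<close> and \<open>skew p\<close> at \<open>z\<close> in direction \<open>v\<close>,
  and the rays have the directions \<open>v\<close> and \<open>v + z\<close>.\<close>

lemma second_order_le:
  assumes p: "p \<in> K" and div: "rays_diverge p" and v: "v \<noteq> 0" and w: "v + z \<noteq> 0"
    and fp: "((\<lambda>s. mink p (z + s *\<^sub>R v)) has_real_derivative fp) (at 0)"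
    and fm: "((\<lambda>s. mink p (- z + s *\<^sub>R v)) has_real_derivative fm) (at 0)"
  shows "0 \<le> finsler p z * ((fp + fm) / 2) + skew p z * ((fp - fm) / 2) - finsler p z * skew p (v + z)
    - (fp - fm) / 2 * (skew p (v + z) - skew p v) + finsler p z * skew p z"
proof -
  define w where "w = v + z"
  have w0: "w \<noteq> 0" and z: "w - v = z" "v - w = - z" using w by (simp_all add: w_def)
  define \<psi> where "\<psi> v w t = (if t = 0 then mink p (w - v) else mink (ray p v t) (ray p w t - ray p v t) / t)" for v w t
  have \<psi>0: "\<psi> v w 0 = mink p (w - v)" for v w by (simp add: \<psi>_def)
  have \<psi>': "(\<psi> v w has_real_derivative (mink p (w - v) * - skew p w +
       \<rho>' * (- skew p w - - skew p v + mink p (w - v)))) (at_right 0)"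
    if "v \<noteq> 0" "w \<noteq> 0" "((\<lambda>s. mink p (w - v + s *\<^sub>R v)) has_real_derivative \<rho>') (at 0)" for v w \<rho>'
    unfolding \<psi>_def[abs_def] ray_eq_speed
    by (rule mink_chord_expansion(2)[OF p _ _ ray_speed_deriv ray_speed_deriv])
      (use p that ray_in_K[OF p, of v] in \<open>auto simp: ray_eq_speed\<close>)
  define m where "m f t = f t * (1 - t * f t / 2) / (1 - t * f t)" for f :: "real \<Rightarrow> real" and t
  have m': "(m f has_real_derivative (f' + (f 0)\<^sup>2 / 2)) (at_right 0)"
    if "(f has_real_derivative f') (at_right 0)" for f f'
    unfolding m_def[abs_def]
    by (auto intro!: derivative_eq_intros that simp: power2_eq_square algebra_simps)
  define g g' where "g = mink p z" and "g' = mink p (- z)"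
  have d1: "(\<psi> v w has_real_derivative g * - skew p w + fp * (- skew p w - - skew p v + g)) (at_right 0)"
    using \<psi>'[OF v w0, unfolded z, OF fp] by (simp add: g_def)
  have "((\<lambda>s. mink p (- z + s *\<^sub>R ((- 1) *\<^sub>R (- z) + 1 *\<^sub>R v))) has_real_derivative (- 1) * mink p (- z) + 1 * fm) (at 0)"
    by (rule mink_deriv_comb[OF p fm])
  then have "((\<lambda>s. mink p (- z + s *\<^sub>R w)) has_real_derivative fm - g') (at 0)"
    by (simp add: w_def g'_def add.commute)
  from \<psi>'[OF w0 v, unfolded z, OF this]
  have d2: "(\<psi> w v has_real_derivative g' * - skew p v + (fm - g') * (- skew p v - - skew p w + g')) (at_right 0)"
    by (simp add: g'_def)
  let ?N = "\<lambda>t. (m (\<psi> v w) t + m (\<psi> w v) t) / 2"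
  let ?D = "((g * - skew p w + fp * (- skew p w - - skew p v + g) + g\<^sup>2 / 2)
    + (g' * - skew p v + (fm - g') * (- skew p v - - skew p w + g') + g'\<^sup>2 / 2)) / 2"
  have D: "(?N has_real_derivative ?D) (at_right 0)"
    using DERIV_cdivide[OF DERIV_add[OF m'[OF d1] m'[OF d2]], of 2]
    by (simp add: \<psi>0 z g_def g'_def)
  obtain \<delta> where \<delta>: "0 < \<delta>" and diverge: "\<And>t. 0 \<le> t \<Longrightarrow> t * finsler p v < \<delta> \<Longrightarrow> t * finsler p w < \<delta> \<Longrightarrow>
      t * finsler p z \<le> dK (ray p v t) (ray p w t)"
    using div v w0 unfolding rays_diverge_def z(1)[symmetric] by blast
  have "0 \<le> ?D"
  proof (rule right_deriv_nonneg[OF D])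
    have "\<forall>\<^sub>F t in at_right 0. t * finsler p u < \<delta>" for u
    proof -
      have "((\<lambda>t. t * finsler p u) \<longlongrightarrow> 0) (at_right 0)"
        by (auto intro!: tendsto_eq_intros tendsto_ident_at)
      then show ?thesis using \<delta> by (rule order_tendstoD)
    qed
    from this[of v] this[of w]
    show "\<forall>\<^sub>F t in at_right 0. ?N 0 \<le> ?N t"
      using eventually_at_right_less[of 0]
    proof eventually_elim
      case (elim t)
      have le: "- ln (1 - mink x (y - x)) / t \<le> m f t" if "x \<in> K" "y \<in> K" "f t = mink x (y - x) / t" for x y f
      proof -
        have "- ln (1 - mink x (y - x)) \<le> mink x (y - x) * (1 - mink x (y - x) / 2) / (1 - mink x (y - x))"
          using that by (intro minus_ln_one_minus_le) (auto simp: mink_diff_less_1)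
        also have "\<dots> = m f t * t"
          using elim by (simp add: m_def that(3))
        finally show ?thesis using pos_divide_le_eq[OF elim(3)] by blast
      qed
      have K: "ray p v t \<in> K" "ray p w t \<in> K" using p by (auto simp: ray_in_K)
      have "?N 0 = finsler p z" by (simp add: m_def \<psi>0 z finsler_def)
      also have "\<dots> \<le> dK (ray p v t) (ray p w t) / t"
        using diverge[of t] elim by (simp add: pos_le_divide_eq mult.commute)
      also have "\<dots> = (- ln (1 - mink (ray p v t) (ray p w t - ray p v t)) / t
           + - ln (1 - mink (ray p w t) (ray p v t - ray p w t)) / t) / 2"
        unfolding hilbert_dist_mink[OF K] using elim by (simp add: field_simps)
      also have "\<dots> \<le> ?N t"
        using K elim by (intro divide_right_mono add_mono le) (auto simp: \<psi>_def)
      finally show ?case .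
    qed
  qed
  moreover have "g = finsler p z + skew p z" "g' = finsler p z - skew p z"
    by (simp_all add: g_def g'_def mink_eq_finsler_skew)
  ultimately show ?thesis
    unfolding w_def[symmetric] by (simp add: power2_eq_square field_simps)
qed

text \<open>Replacing the pair of directions \<open>v\<close>, \<open>w = v + z\<close> by \<open>- w\<close>, \<open>- v\<close> keeps \<open>z = w - v\<close> and changes the sign of
  the second-order term: the inequality is an equality.\<close>

lemma second_order_eq:
  assumes p: "p \<in> K" and div: "rays_diverge p" and v: "v \<noteq> 0" and w: "v + z \<noteq> 0"
    and fp: "((\<lambda>s. mink p (z + s *\<^sub>R v)) has_real_derivative fp) (at 0)"
    and fm: "((\<lambda>s. mink p (- z + s *\<^sub>R v)) has_real_derivative fm) (at 0)"
  shows "finsler p z * ((fp + fm) / 2) + skew p z * ((fp - fm) / 2) - finsler p z * skew p (v + z)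
    - (fp - fm) / 2 * (skew p (v + z) - skew p v) + finsler p z * skew p z = 0" (is "?L = 0")
proof -
  have "((\<lambda>s. mink p (z + s *\<^sub>R ((- 1) *\<^sub>R z + (- 1) *\<^sub>R v))) has_real_derivative (- 1) * mink p z + (- 1) * fp) (at 0)"
    by (rule mink_deriv_comb[OF p fp])
  then have 1: "((\<lambda>s. mink p (z + s *\<^sub>R (- (v + z)))) has_real_derivative - mink p z - fp) (at 0)"
    by (rule back_subst[where P = "\<lambda>f. (f has_real_derivative _) _", THEN DERIV_cong]) (simp_all add: algebra_simps)
  have "((\<lambda>s. mink p (- z + s *\<^sub>R (1 *\<^sub>R (- z) + (- 1) *\<^sub>R v))) has_real_derivative 1 * mink p (- z) + (- 1) * fm) (at 0)"
    by (rule mink_deriv_comb[OF p fm])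
  then have 2: "((\<lambda>s. mink p (- z + s *\<^sub>R (- (v + z)))) has_real_derivative mink p (- z) - fm) (at 0)"
    by (rule back_subst[where P = "\<lambda>f. (f has_real_derivative _) _", THEN DERIV_cong]) (simp_all add: algebra_simps)
  have e: "- (v + z) + z = - v" by simp
  have n: "- (v + z) \<noteq> 0" "- (v + z) + z \<noteq> 0" unfolding e using v w by (auto simp: neg_equal_0_iff_equal simp del: minus_add_distrib)
  have "0 \<le> - ?L"
    using second_order_le[OF p div n 1 2] unfolding e skew_minus mink_eq_finsler_skew
    by (simp add: field_simps)
  moreover have "0 \<le> ?L" by (rule second_order_le[OF assms])
  ultimately show ?thesis by simp
qed

text \<open>The previous equation for the directions \<open>v\<close> and \<open>v + e z\<close>, divided by \<open>e\<close>, in the limit \<open>e \<rightarrow> 0\<close>. The roles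
  of \<open>v\<close> and \<open>z\<close> have become symmetric, which is what makes it strong.\<close>

lemma skew_deriv_relation:
  assumes p: "p \<in> K" and div: "rays_diverge p" and v: "v \<noteq> 0"
    and fp: "((\<lambda>s. mink p (z + s *\<^sub>R v)) has_real_derivative fp) (at 0)"
    and fm: "((\<lambda>s. mink p (- z + s *\<^sub>R v)) has_real_derivative fm) (at 0)"
    and h': "((\<lambda>s. skew p (v + s *\<^sub>R z)) has_real_derivative h') (at 0)"
  shows "finsler p z * ((fp + fm) / 2 - skew p v) = (fp - fm) / 2 * (h' - skew p z)"
proof -
  let ?H = "(fp + fm) / 2" and ?P = "(fp - fm) / 2"
  have lim0: "((\<lambda>e. v + e *\<^sub>R z) \<longlongrightarrow> v) (at_right 0)"
    by (auto intro!: tendsto_eq_intros tendsto_ident_at)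
  have quot: "((\<lambda>e. (skew p (v + e *\<^sub>R z) - skew p v) / e) \<longlongrightarrow> h') (at_right 0)"
    using DERIV_subset[OF h', of "{0<..}"] by (simp add: has_field_derivative_iff)
  define Q where "Q e = finsler p z * ?H + skew p z * ?P - finsler p z * skew p (v + e *\<^sub>R z)
      - ?P * ((skew p (v + e *\<^sub>R z) - skew p v) / e) + e * (finsler p z * skew p z)" for e
  have Q: "(Q \<longlongrightarrow>
      finsler p z * ?H + skew p z * ?P - finsler p z * skew p v - ?P * h' + 0 * (finsler p z * skew p z)) (at_right 0)"
    unfolding Q_def[abs_def]
    by (intro tendsto_add tendsto_diff tendsto_mult tendsto_const quot tendsto_skew p lim0 tendsto_ident_at)
  have "\<forall>\<^sub>F e in at_right 0. v + e *\<^sub>R z \<noteq> 0"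
    using lim0 v by (rule tendsto_imp_eventually_ne)
  then have ev: "\<forall>\<^sub>F e in at_right 0. Q e = 0"
    using eventually_at_right_less[of 0]
  proof eventually_elim
    case (elim e)
    have fm': "((\<lambda>s. mink p (- (e *\<^sub>R z) + s *\<^sub>R v)) has_real_derivative fm) (at 0)"
      using mink_deriv_scale[OF p fm elim(2)] by simp
    from second_order_eq[OF p div v elim(1) mink_deriv_scale[OF p fp elim(2)] fm']
    have "e * Q e = 0"
      using elim p by (simp add: Q_def finsler_scaleR skew_scaleR field_simps)
    then show ?case using elim by simp
  qed
  have "((\<lambda>e::real. 0::real) \<longlongrightarrow>
      finsler p z * ?H + skew p z * ?P - finsler p z * skew p v - ?P * h' + 0 * (finsler p z * skew p z)) (at_right 0)"
    by (rule Lim_transform_eventually[OF Q ev])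
  then have "finsler p z * ?H + skew p z * ?P - finsler p z * skew p v - ?P * h' + 0 * (finsler p z * skew p z) = 0"
    by (intro tendsto_unique[OF trivial_limit_at_right_real _ tendsto_const])
  then show ?thesis by (simp add: field_simps)
qed

end

section \<open>Convex functions of one real variable\<close>

lemma convex_deriv_subgradient:
  fixes f :: "real \<Rightarrow> real"
  assumes "convex_on UNIV f" and "(f has_real_derivative D) (at x)"
  shows "f x + D * (y - x) \<le> f y"
  using convex_on_imp_above_tangent[OF assms(1), of x y D] assms(2) by (simp add: algebra_simps)

text \<open>A monotone choice of subgradients is discontinuous at only countably many points, and where it
  is continuous it is the derivative.\<close>

lemma countable_nondifferentiable_convex:
  fixes f :: "real \<Rightarrow> real"
  assumes cvx: "convex_on UNIV f"
  shows "countable {x. \<not> f differentiable (at x)}"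
proof -
  define m where "m x = Inf ((\<lambda>t. (f x - f t) / (x - t)) ` ({x<..} \<inter> UNIV))" for x
  have sub: "f x + m x * (y - x) \<le> f y" for x y
    using convex_le_Inf_differential[OF cvx, of x y] by (simp add: m_def)
  have "mono m"
  proof (rule monoI)
    fix x y :: real assume "x \<le> y"
    have "0 \<le> (m y - m x) * (y - x)" using sub[of x y] sub[of y x] by (simp add: algebra_simps)
    then show "m x \<le> m y" using \<open>x \<le> y\<close> by (cases "x = y") (auto simp: zero_le_mult_iff)
  qed
  have "f differentiable (at x)" if cont: "isCont m x" for x
  proof -
    have "((\<lambda>y. (f y - f x) / (y - x) - m x) \<longlongrightarrow> 0) (at x)"
    proof (rule Lim_null_comparison)
      have "\<bar>(f y - f x) / (y - x) - m x\<bar> \<le> \<bar>m y - m x\<bar>" if "y \<noteq> x" for y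
      proof -
        have 1: "(f y - f x) / (y - x) - m x = (f y - f x - m x * (y - x)) / (y - x)"
          using that by (simp add: field_simps)
        have "\<bar>f y - f x - m x * (y - x)\<bar> \<le> \<bar>(m y - m x) * (y - x)\<bar>"
          using sub[of x y] sub[of y x] by (simp add: algebra_simps abs_le_iff)
        then show ?thesis
          unfolding 1 using that by (simp add: abs_mult divide_le_eq)
      qed
      then show "\<forall>\<^sub>F y in at x. norm ((f y - f x) / (y - x) - m x) \<le> \<bar>m y - m x\<bar>"
        by (auto simp: eventually_at_filter)
      show "((\<lambda>y. \<bar>m y - m x\<bar>) \<longlongrightarrow> 0) (at x)"
        using cont by (auto intro!: tendsto_eq_intros simp: isCont_def)
    qed
    then have "(f has_real_derivative m x) (at x)"
      by (simp add: has_field_derivative_iff Lim_null[symmetric])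
    then show ?thesis by (auto simp: real_differentiable_def)
  qed
  then have "{x. \<not> f differentiable (at x)} \<subseteq> {x. \<not> isCont m x}" by blast
  then show ?thesis using mono_ctble_discont[OF \<open>mono m\<close>] countable_subset by blast
qed

lemma closure_differentiable_convex:
  fixes f g :: "real \<Rightarrow> real"
  assumes "convex_on UNIV f" "convex_on UNIV g"
  shows "closure {x. f differentiable (at x) \<and> g differentiable (at x)} = UNIV"
proof -
  have "countable ({x. \<not> f differentiable (at x)} \<union> {x. \<not> g differentiable (at x)})"
    using assms by (simp add: countable_nondifferentiable_convex)
  then have "\<exists>x\<in>U. f differentiable (at x) \<and> g differentiable (at x)" if "open U" "U \<noteq> {}" for U
    using open_minus_countable[OF _ that(2,1)] by blast
  note meets = this
  let ?C = "{x. f differentiable (at x) \<and> g differentiable (at x)}"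
  show ?thesis
  proof (rule ccontr)
    assume "closure ?C \<noteq> UNIV"
    then have "- closure ?C \<noteq> {}" by auto
    with meets[of "- closure ?C"] obtain x where "x \<in> - closure ?C" "x \<in> ?C" by auto
    then show False using closure_subset[of ?C] by auto
  qed
qed

lemma dense_imp_all:
  fixes S :: "real set"
  assumes "closure S = UNIV" "closed {x. Q x}" "\<And>x. x \<in> S \<Longrightarrow> Q x"
  shows "Q x"
proof -
  have "closure S \<subseteq> {x. Q x}" using assms by (intro closure_minimal) auto
  then show ?thesis using assms(1) by auto
qed

text \<open>Write \<open>T x\<close> for the tangent line of \<open>P\<close> at \<open>x\<close>. Using \<open>rel\<close> for \<open>(x, y)\<close> and for \<open>(y, x)\<close>,
  the deviation \<open>H x + (y - x) * H' x - H y\<close> can only be nonzero if \<open>\<bar>T x y\<bar> = P y\<close>. So \<open>H\<close> is affine on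
  the open set where \<open>\<bar>T x\<bar> < P\<close>. If \<open>x'\<close> lies in the open set of \<open>x\<close>, then the sets of \<open>x\<close> and \<open>x'\<close> together cover
  \<open>S\<close>: at a point \<open>y\<close> outside both, \<open>T y\<close> would agree up to sign with both tangent lines, but
  \<open>\<bar>T x x'\<bar> < P x' = \<bar>T x' x'\<bar>\<close>.\<close>

lemma affine_of_tangent_relation:
  fixes P H P' H' :: "real \<Rightarrow> real" and S :: "real set"
  assumes S: "closure S = UNIV"
    and P: "\<And>x. x \<in> S \<Longrightarrow> (P has_real_derivative P' x) (at x)"
    and H: "\<And>x. x \<in> S \<Longrightarrow> (H has_real_derivative H' x) (at x)"
    and contP: "continuous_on UNIV P" and contH: "continuous_on UNIV H"
    and pos: "\<And>x. 0 < P x" and unbounded: "\<And>c. \<exists>x. c < P x"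
    and tangent: "\<And>x y. x \<in> S \<Longrightarrow> \<bar>P x + (y - x) * P' x\<bar> \<le> P y"
    and rel: "\<And>x y. x \<in> S \<Longrightarrow> y \<in> S \<Longrightarrow>
      P y * (H y + (x - y) * H' y - H x) = (P y + (x - y) * P' y) * (H x + (y - x) * H' x - H y)"
  shows "\<exists>A B. \<forall>x. H x = A + B * x"
proof -
  define T where "T x y = P x + (y - x) * P' x" for x y
  define L where "L x y = H x + (y - x) * H' x" for x y
  define U where "U x = {y. \<bar>T x y\<bar> < P y}" for x
  have Txx: "T x x = P x" for x by (simp add: T_def)
  have on_U_S: "H y = L x y" if xy: "x \<in> S" "y \<in> S" "y \<in> U x" for x y
  proof (rule ccontr)
    assume ne: "H y \<noteq> L x y"
    have r: "P y * (L y x - H x) = T y x * (L x y - H y)" "P x * (L x y - H y) = T x y * (L y x - H x)"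
      using rel[OF xy(1,2)] rel[OF xy(2,1)] by (simp_all add: T_def L_def)
    have "P x * P y * (L x y - H y) = P y * (T x y * (L y x - H x))"
      using r(2) by simp
    also have "\<dots> = T x y * (P y * (L y x - H x))" by simp
    also have "\<dots> = T x y * T y x * (L x y - H y)" using r(1) by simp
    finally have "P x * P y = T x y * T y x" using ne by simp
    then have "P x * P y = \<bar>T x y\<bar> * \<bar>T y x\<bar>"
      using pos[of x] pos[of y] by (metis abs_mult abs_of_pos mult_pos_pos)
    also have "\<dots> \<le> \<bar>T x y\<bar> * P x"
      using tangent[OF xy(2), of x] by (intro mult_left_mono) (auto simp: T_def)
    also have "\<dots> < P y * P x"
      using xy(3) pos[of x] by (simp add: U_def)
    finally show False by simp
  qed
  have openU: "open (U x)" for x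
    unfolding U_def T_def using contP
    by (intro open_Collect_less continuous_intros)
  have on_U: "H y = L x y" if x: "x \<in> S" and y: "y \<in> U x" for x y
  proof -
    have eq: "{y. y \<in> U x \<longrightarrow> H y = L x y} = - U x \<union> {y. H y = L x y}" by auto
    have "y \<in> U x \<longrightarrow> H y = L x y"
    proof (rule dense_imp_all[OF S, where Q = "\<lambda>y. y \<in> U x \<longrightarrow> H y = L x y"])
      have "closed {y. H y = L x y}"
        unfolding L_def using contH by (intro closed_Collect_eq continuous_intros)
      then show "closed {y. y \<in> U x \<longrightarrow> H y = L x y}"
        unfolding eq using openU[of x] by (intro closed_Un closed_Compl)
    qed (use on_U_S[OF x] in blast)
    with y show ?thesis by blast
  qed
  obtain x where x: "x \<in> S" using S by fastforce
  \<comment> \<open>Otherwise \<open>P\<close> would be the absolute value of an affine function without zeros, hence constant.\<close>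
  have "U x \<noteq> {}"
  proof
    assume "U x = {}"
    then have eq: "P y = \<bar>T x y\<bar>" for y
    proof -
      have "\<not> \<bar>T x y\<bar> < P y" using \<open>U x = {}\<close> unfolding U_def by (metis empty_iff mem_Collect_eq)
      then show ?thesis using tangent[OF x, of y] by (simp add: T_def)
    qed
    have "P' x = 0"
    proof (rule ccontr)
      assume "P' x \<noteq> 0"
      then have "T x (x - P x / P' x) = 0" by (simp add: T_def)
      then show False using eq[of "x - P x / P' x"] pos[of "x - P x / P' x"] by simp
    qed
    then have "P y = P x" for y using eq[of y] pos[of x] by (simp add: T_def)
    with unbounded[of "P x"] show False by (metis less_irrefl)
  qed
  then have "U x \<inter> S \<noteq> {}"
    using open_Int_closure_eq_empty[OF openU, of x S] S by simp
  then obtain x' where x': "x' \<in> S" "x' \<in> U x" by auto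
  have same: "L x' y = L x y" for y
  proof -
    have "((\<lambda>y. L x y) has_real_derivative H' x) (at x')"
      unfolding L_def by (auto intro!: derivative_eq_intros)
    moreover have "\<forall>\<^sub>F y in nhds x'. H y = L x y"
      using eventually_nhds_in_open[OF openU x'(2)] by eventually_elim (rule on_U[OF x])
    ultimately have "(H has_real_derivative H' x) (at x')"
      by (subst DERIV_cong_ev[OF refl _ refl])
    then have "H' x' = H' x" using H[OF x'(1)] DERIV_unique by blast
    moreover have "H x' = L x x'" by (rule on_U[OF x x'(2)])
    ultimately show ?thesis by (simp add: L_def algebra_simps)
  qed
  have on_S: "H y = L x y" if y: "y \<in> S" for y
  proof (cases "y \<in> U x \<or> y \<in> U x'")
    case True
    then show ?thesis using on_U[OF x] on_U[OF x'(1)] same by auto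
  next
    case False
    have touch: "\<bar>T u t\<bar> = \<bar>T y t\<bar>" if u: "u \<in> S" "y \<notin> U u" for u t
    proof -
      have Py: "P y = \<bar>T u y\<bar>" using u tangent[OF u(1), of y] by (simp add: U_def T_def)
      obtain c :: real where c: "\<bar>c\<bar> = 1" "P y = c * T u y"
      proof (cases "0 \<le> T u y")
        case True
        then show ?thesis using that[of 1] Py by simp
      next
        case False
        then show ?thesis using that[of "- 1"] Py by simp
      qed
      have le: "c * T u s \<le> P s" for s
      proof -
        have "c * T u s \<le> \<bar>c * T u s\<bar>" by simp
        also have "\<dots> = \<bar>T u s\<bar>" using c(1) by (simp add: abs_mult)
        also have "\<dots> \<le> P s" using tangent[OF u(1)] by (simp add: T_def)
        finally show ?thesis .
      qed
      have "((\<lambda>s. P s - c * T u s) has_real_derivative P' y - c * P' u) (at y)"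
        unfolding T_def by (auto intro!: derivative_eq_intros P[OF y])
      then have "P' y - c * P' u = 0"
        by (rule DERIV_local_min[where d = 1]) (use c le in auto)
      then have "T y t = c * T u t" using c(2) by (simp add: T_def algebra_simps)
      then show ?thesis using c(1) by (simp add: abs_mult)
    qed
    have "\<bar>T x x'\<bar> = \<bar>T x' x'\<bar>" using touch[OF x] touch[OF x'(1)] False by simp
    then show ?thesis using x'(2) pos[of x'] by (simp add: U_def Txx)
  qed
  have "H y = L x y" for y
  proof (rule dense_imp_all[OF S, where Q = "\<lambda>y. H y = L x y"])
    show "closed {y. H y = L x y}"
      unfolding L_def using contH by (intro closed_Collect_eq continuous_intros)
  qed (rule on_S)
  then have "H y = (H x - x * H' x) + H' x * y" for y by (simp add: L_def algebra_simps)
  then show ?thesis by blast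
qed

text \<open>The function \<open>W\<close> minus the quadratic with the same subgradients satisfies
  \<open>\<bar>k y - k x\<bar> \<le> C (y - x)\<^sup>2\<close>, so it is constant.\<close>

lemma quadratic_of_affine_subgradient:
  fixes W :: "real \<Rightarrow> real"
  assumes sub: "\<And>x y. W x + (\<alpha> + \<beta> * x) * (y - x) \<le> W y"
  shows "W x = W 0 + \<alpha> * x + \<beta> / 2 * x\<^sup>2"
proof -
  define k where "k x = W x - \<alpha> * x - \<beta> / 2 * x\<^sup>2" for x
  have k: "\<bar>k y - k x\<bar> \<le> \<bar>\<beta>\<bar> / 2 * (y - x)\<^sup>2" for x y
  proof -
    have "- (\<beta> / 2 * (y - x)\<^sup>2) \<le> k y - k x" for x y
      using sub[of x y] by (simp add: k_def power2_eq_square field_simps)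
    from this[of x y] this[of y x] have "\<bar>k y - k x\<bar> \<le> \<beta> / 2 * (y - x)\<^sup>2"
      unfolding power2_commute[of y x] by linarith
    also have "\<dots> \<le> \<bar>\<beta>\<bar> / 2 * (y - x)\<^sup>2" by (intro mult_right_mono) auto
    finally show ?thesis .
  qed
  have "(k has_real_derivative 0) (at x)" for x
    unfolding has_field_derivative_iff
  proof (rule Lim_null_comparison)
    have "\<bar>(k y - k x) / (y - x)\<bar> \<le> \<bar>\<beta>\<bar> / 2 * \<bar>y - x\<bar>" if "y \<noteq> x" for y
    proof -
      have "\<bar>k y - k x\<bar> \<le> \<bar>\<beta>\<bar> / 2 * \<bar>y - x\<bar> * \<bar>y - x\<bar>"
        using k[of y x] by (simp add: power2_eq_square mult.assoc flip: abs_mult)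
      then show ?thesis using that by (simp add: abs_divide divide_le_eq)
    qed
    then show "\<forall>\<^sub>F y in at x. norm ((k y - k x) / (y - x)) \<le> \<bar>\<beta>\<bar> / 2 * \<bar>y - x\<bar>"
      by (auto simp: eventually_at_filter)
    show "((\<lambda>y. \<bar>\<beta>\<bar> / 2 * \<bar>y - x\<bar>) \<longlongrightarrow> 0) (at x)"
      by (auto intro!: tendsto_eq_intros)
  qed
  then have "k x = k 0" by (intro DERIV_isconst_all) auto
  then show ?thesis by (simp add: k_def)
qed

section \<open>Busemann bodies are ellipsoids\<close>

context bounded_convex_open
begin

lemma convex_on_mink_line: "p \<in> K \<Longrightarrow> convex_on UNIV (\<lambda>x. mink p (a + x *\<^sub>R b))"
proof (rule convex_onI)
  fix t x y :: real assume p: "p \<in> K" and t: "0 < t" "t < 1"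
  have "a + ((1 - t) *\<^sub>R x + t *\<^sub>R y) *\<^sub>R b = (1 - t) *\<^sub>R (a + x *\<^sub>R b) + t *\<^sub>R (a + y *\<^sub>R b)"
    by (simp add: algebra_simps)
  then show "mink p (a + ((1 - t) *\<^sub>R x + t *\<^sub>R y) *\<^sub>R b) \<le> (1 - t) * mink p (a + x *\<^sub>R b) + t * mink p (a + y *\<^sub>R b)"
    using convex_onD[OF convex_on_mink[OF p], of t "a + x *\<^sub>R b" "a + y *\<^sub>R b"] t by simp
qed simp

text \<open>In the plane of \<open>a\<close> and \<open>b\<close>, every direction other than \<open>\<plusminus> b\<close> is a positive multiple of some \<open>\<plusminus> (a + x b)\<close>. Smoothness is required in both
  opposite directions, because \<open>finsler\<close> and \<open>skew\<close> combine them.\<close>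

definition smooth_on_line :: "real ^ 'n \<Rightarrow> real ^ 'n \<Rightarrow> real ^ 'n \<Rightarrow> real set" where
  "smooth_on_line p a b = {x. (\<lambda>x. mink p (a + x *\<^sub>R b)) differentiable (at x) \<and>
     (\<lambda>x. mink p (- a + x *\<^sub>R (- b))) differentiable (at x)}"

lemma closure_smooth_on_line: "p \<in> K \<Longrightarrow> closure (smooth_on_line p a b) = UNIV"
  unfolding smooth_on_line_def by (intro closure_differentiable_convex convex_on_mink_line)

lemma smooth_on_lineE:
  assumes "x \<in> smooth_on_line p a b"
  obtains gp gm where
    "((\<lambda>x. mink p (a + x *\<^sub>R b)) has_real_derivative gp) (at x)"
    "((\<lambda>x. mink p (- (a + x *\<^sub>R b))) has_real_derivative gm) (at x)"
    "((\<lambda>s. mink p (a + x *\<^sub>R b + s *\<^sub>R b)) has_real_derivative gp) (at 0)"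
    "((\<lambda>s. mink p (- (a + x *\<^sub>R b) + s *\<^sub>R b)) has_real_derivative - gm) (at 0)"
proof -
  obtain gp gm where g:
    "((\<lambda>x. mink p (a + x *\<^sub>R b)) has_real_derivative gp) (at x)"
    "((\<lambda>x. mink p (- a + x *\<^sub>R (- b))) has_real_derivative gm) (at x)"
    using assms by (auto simp: smooth_on_line_def real_differentiable_def)
  have d: "((\<lambda>s. x + s) has_real_derivative 1) (at 0)" "((\<lambda>s. x - s) has_real_derivative - 1) (at 0)"
    by (auto intro!: derivative_eq_intros)
  have "((\<lambda>s. mink p (a + (x + s) *\<^sub>R b)) has_real_derivative gp * 1) (at 0)"
    by (rule DERIV_chain2[where f = "\<lambda>x. mink p (a + x *\<^sub>R b)" and g = "\<lambda>s. x + s", OF _ d(1)])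
      (use g in simp)
  moreover have "((\<lambda>s. mink p (- a + (x - s) *\<^sub>R (- b))) has_real_derivative gm * - 1) (at 0)"
    by (rule DERIV_chain2[where f = "\<lambda>x. mink p (- a + x *\<^sub>R (- b))" and g = "\<lambda>s. x - s", OF _ d(2)])
      (use g in simp)
  ultimately show thesis
    using g by (intro that[of gp gm]) (simp_all add: algebra_simps)
qed

lemma continuous_on_finsler_line: "p \<in> K \<Longrightarrow> continuous_on UNIV (\<lambda>x. finsler p (a + x *\<^sub>R b))"
  and continuous_on_skew_line: "p \<in> K \<Longrightarrow> continuous_on UNIV (\<lambda>x. skew p (a + x *\<^sub>R b))"
  unfolding continuous_on_def by (auto intro!: tendsto_intros)

text \<open>Recovers the value in the one direction that the line \<open>a + x b\<close> misses.\<close>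

lemma tendsto_line_at_top:
  fixes f :: "real ^ 'n \<Rightarrow> real"
  assumes f: "\<And>g l (F :: real filter). (g \<longlongrightarrow> l) F \<Longrightarrow> ((\<lambda>t. f (g t)) \<longlongrightarrow> f l) F"
    and scale: "\<And>c v. 0 \<le> c \<Longrightarrow> f (c *\<^sub>R v) = c * f v"
  shows "((\<lambda>x. f (a + x *\<^sub>R b) / x) \<longlongrightarrow> f b) at_top"
proof -
  have "((\<lambda>x. (1 / x) *\<^sub>R a + b) \<longlongrightarrow> 0 *\<^sub>R a + b) at_top"
    by (intro tendsto_intros tendsto_divide_0[OF tendsto_const] filterlim_at_top_imp_at_infinity filterlim_ident)
  then have "((\<lambda>x. f ((1 / x) *\<^sub>R a + b)) \<longlongrightarrow> f b) at_top"
    using f by simp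
  then show ?thesis
  proof (rule Lim_transform_eventually)
    show "\<forall>\<^sub>F x in at_top. f ((1 / x) *\<^sub>R a + b) = f (a + x *\<^sub>R b) / x"
      using eventually_gt_at_top[of 0]
    proof eventually_elim
      case (elim x)
      have "f ((1 / x) *\<^sub>R a + b) = f ((1 / x) *\<^sub>R (a + x *\<^sub>R b))"
        using elim by (simp add: scaleR_right_distrib)
      then show ?case using elim by (subst (asm) scale) auto
    qed
  qed
qed

text \<open>For \<open>v = a + x b\<close> and \<open>z = a + y b\<close>, the relation between the derivatives of \<open>finsler\<close> and \<open>skew\<close> at \<open>v\<close> and \<open>z\<close>
  becomes a relation between tangent lines.\<close>

lemma skew_affine_on_line:
  assumes p: "p \<in> K" and div: "rays_diverge p" and indep: "\<And>x. a + x *\<^sub>R b \<noteq> 0" and b: "b \<noteq> 0"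
  shows "\<exists>A B. \<forall>x. skew p (a + x *\<^sub>R b) = A + B * x"
proof -
  define S where "S = smooth_on_line p a b"
  define P where "P x = finsler p (a + x *\<^sub>R b)" for x
  define h where "h x = skew p (a + x *\<^sub>R b)" for x
  define gp gm where "gp x = deriv (\<lambda>x. mink p (a + x *\<^sub>R b)) x"
    and "gm x = deriv (\<lambda>x. mink p (- (a + x *\<^sub>R b))) x" for x
  have g: "((\<lambda>x. mink p (a + x *\<^sub>R b)) has_real_derivative gp x) (at x)"
    "((\<lambda>x. mink p (- (a + x *\<^sub>R b))) has_real_derivative gm x) (at x)"
    "((\<lambda>s. mink p (a + x *\<^sub>R b + s *\<^sub>R b)) has_real_derivative gp x) (at 0)"
    "((\<lambda>s. mink p (- (a + x *\<^sub>R b) + s *\<^sub>R b)) has_real_derivative - gm x) (at 0)" if "x \<in> S" for x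
    using that unfolding S_def
    by (auto elim!: smooth_on_lineE simp: gp_def gm_def DERIV_imp_deriv)
  define P' h' where "P' x = (gp x + gm x) / 2" and "h' x = (gp x - gm x) / 2" for x
  have dP: "(P has_real_derivative P' x) (at x)" and dh: "(h has_real_derivative h' x) (at x)" if "x \<in> S" for x
    unfolding P_def[abs_def] h_def[abs_def] finsler_def skew_def P'_def h'_def
    by (intro DERIV_cdivide DERIV_add DERIV_diff g that)+
  have "convex_on UNIV (\<lambda>x. mink p (a + x *\<^sub>R b) / 2 + mink p (- a + x *\<^sub>R (- b)) / 2)"
    by (intro convex_on_add convex_on_cdiv convex_on_mink_line p) simp_all
  then have cvx: "convex_on UNIV P" by (simp add: P_def[abs_def] finsler_def add_divide_distrib)
  have "\<exists>A B. \<forall>x. h x = A + B * x"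
  proof (rule affine_of_tangent_relation[of S P P' h h'])
    show "closure S = UNIV" unfolding S_def by (rule closure_smooth_on_line[OF p])
    show "continuous_on UNIV P" "continuous_on UNIV h"
      unfolding P_def[abs_def] h_def[abs_def]
      by (rule continuous_on_finsler_line[OF p] continuous_on_skew_line[OF p])+
    show "0 < P x" for x using finsler_pos[OF p indep] by (simp add: P_def)
    show "\<exists>x. c < P x" for c
    proof -
      define x where "x = (\<bar>c\<bar> + finsler p a + 1) / finsler p b"
      have fb: "0 < finsler p b" using finsler_pos[OF p b] .
      have x0: "0 \<le> x" using fb p by (simp add: x_def)
      have "finsler p (x *\<^sub>R b) \<le> finsler p (a + x *\<^sub>R b) + finsler p (- a)"
        using finsler_add_le[OF p, of "a + x *\<^sub>R b" "- a"] by simp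
      moreover have "finsler p (x *\<^sub>R b) = \<bar>c\<bar> + finsler p a + 1"
        using fb x0 p by (simp add: finsler_scaleR) (simp add: x_def)
      ultimately have "c < P x" by (simp add: P_def)
      then show ?thesis ..
    qed
    show "\<bar>P x + (y - x) * P' x\<bar> \<le> P y" if x: "x \<in> S" for x y
    proof -
      have "P x + (y - x) * P' x \<le> P y"
        using convex_deriv_subgradient[OF cvx dP[OF x], of y] by (simp add: mult.commute)
      moreover have "- (P x + (y - x) * P' x) \<le> P y"
      proof -
        \<comment> \<open>The tangent line at \<open>x\<close> is also a support line at the reflected point, whose direction is
          \<open>2 v - w\<close> for \<open>v = a + x b\<close> and \<open>w = a + y b\<close>.\<close>
        have "P x + P' x * ((2 * x - y) - x) \<le> P (2 * x - y)"
          by (rule convex_deriv_subgradient[OF cvx dP[OF x]])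
        also have "\<dots> = finsler p (2 *\<^sub>R (a + x *\<^sub>R b) + - (a + y *\<^sub>R b))"
          by (simp add: P_def algebra_simps scaleR_2)
        also have "\<dots> \<le> finsler p (2 *\<^sub>R (a + x *\<^sub>R b)) + finsler p (- (a + y *\<^sub>R b))"
          by (rule finsler_add_le[OF p])
        also have "\<dots> = 2 * P x + P y"
          using finsler_scaleR[OF p, of 2 "a + x *\<^sub>R b"] finsler_minus[of p "a + y *\<^sub>R b"]
          by (simp add: P_def)
        finally show ?thesis by (simp add: algebra_simps)
      qed
      ultimately show ?thesis by (simp add: abs_le_iff)
    qed
    show "(P has_real_derivative P' x) (at x)" "(h has_real_derivative h' x) (at x)" if "x \<in> S" for x
      using dP dh that by auto
    show "P y * (h y + (x - y) * h' y - h x) = (P y + (x - y) * P' y) * (h x + (y - x) * h' x - h y)"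
      if x: "x \<in> S" and y: "y \<in> S" for x y
    proof -
      define v z where "v = a + x *\<^sub>R b" and "z = a + y *\<^sub>R b"
      note gx = g[OF x, folded v_def] and gy = g[OF y, folded z_def]
      have v: "v = 1 *\<^sub>R z + (x - y) *\<^sub>R b" "v = (- 1) *\<^sub>R (- z) + (x - y) *\<^sub>R b"
        and z: "z = 1 *\<^sub>R v + (y - x) *\<^sub>R b" "- z = 1 *\<^sub>R (- v) + (x - y) *\<^sub>R b"
        by (simp_all add: v_def z_def algebra_simps)
      have fp: "((\<lambda>s. mink p (z + s *\<^sub>R v)) has_real_derivative 1 * mink p z + (x - y) * gp y) (at 0)"
        by (subst v(1)) (rule mink_deriv_comb[OF p gy(3)])
      have fm: "((\<lambda>s. mink p (- z + s *\<^sub>R v)) has_real_derivative (- 1) * mink p (- z) + (x - y) * - gm y) (at 0)"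
        by (subst v(2)) (rule mink_deriv_comb[OF p gy(4)])
      have hp: "((\<lambda>s. mink p (v + s *\<^sub>R z)) has_real_derivative 1 * mink p v + (y - x) * gp x) (at 0)"
        by (subst z(1)) (rule mink_deriv_comb[OF p gx(3)])
      have "((\<lambda>s. mink p (- v + s *\<^sub>R (- z))) has_real_derivative 1 * mink p (- v) + (x - y) * - gm x) (at 0)"
        by (subst z(2)) (rule mink_deriv_comb[OF p gx(4)])
      then have hm: "((\<lambda>s. mink p (- (v + s *\<^sub>R z))) has_real_derivative 1 * mink p (- v) + (x - y) * - gm x) (at 0)"
        by simp
      have h: "((\<lambda>s. skew p (v + s *\<^sub>R z)) has_real_derivative
          ((1 * mink p v + (y - x) * gp x) - (1 * mink p (- v) + (x - y) * - gm x)) / 2) (at 0)"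
        unfolding skew_def by (intro DERIV_cdivide DERIV_diff hp hm)
      have "v \<noteq> 0" using indep by (simp add: v_def)
      from skew_deriv_relation[OF p div this fp fm h]
      show ?thesis
        unfolding P_def h_def P'_def h'_def v_def[symmetric] z_def[symmetric] mink_eq_finsler_skew
        by (simp add: field_simps)
    qed
  qed
  then show ?thesis by (simp add: h_def)
qed

lemma skew_add:
  assumes p: "p \<in> K" and div: "rays_diverge p"
  shows "skew p (a + b) = skew p a + skew p b"
proof (cases "b = 0 \<or> (\<exists>x. a + x *\<^sub>R b = 0)")
  case True
  have [simp]: "skew p 0 = 0" by (simp add: skew_def)
  show ?thesis
  proof (cases "b = 0")
    case False
    with True obtain x where "a = (- x) *\<^sub>R b" by (auto simp: eq_neg_iff_add_eq_0)
    moreover have "(- x) *\<^sub>R b + b = (1 - x) *\<^sub>R b" by (simp add: algebra_simps)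
    ultimately show ?thesis using p by (simp add: skew_scaleR left_diff_distrib del: scaleR_minus_left)
  qed simp
next
  case False
  then obtain A B where AB: "skew p (a + x *\<^sub>R b) = A + B * x" for x
    using skew_affine_on_line[OF p div] by blast
  have "((\<lambda>x. skew p (a + x *\<^sub>R b) / x) \<longlongrightarrow> skew p b) at_top"
    by (rule tendsto_line_at_top) (use p in \<open>auto intro: tendsto_skew simp: skew_scaleR\<close>)
  moreover have "((\<lambda>x. skew p (a + x *\<^sub>R b) / x) \<longlongrightarrow> B) at_top"
    unfolding AB by real_asymp
  ultimately have "skew p b = B" by (intro tendsto_unique[OF trivial_limit_at_top_linorder])
  then show ?thesis using AB[of 0] AB[of 1] by simp
qed

text \<open>Moving the base point along \<open>u\<close> changes \<open>mink p z\<close> at a rate that is its own value times its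
  derivative at \<open>z\<close> in direction \<open>u\<close>. This is the chord expansion with both speeds constant.\<close>

lemma skew_base_deriv:
  assumes p: "p \<in> K"
    and fp: "((\<lambda>s. mink p (z + s *\<^sub>R u)) has_real_derivative fp) (at 0)"
    and fm: "((\<lambda>s. mink p (- z + s *\<^sub>R u)) has_real_derivative fm) (at 0)"
  shows "((\<lambda>s. skew (p + s *\<^sub>R u) z) has_real_derivative (fp * mink p z - fm * mink p (- z)) / 2) (at_right 0)"
proof -
  have "((\<lambda>s. p + s *\<^sub>R u) \<longlongrightarrow> p) (at_right 0)"
    by (auto intro!: tendsto_eq_intros tendsto_ident_at)
  then have K: "\<forall>\<^sub>F s in at_right 0. p + s *\<^sub>R u \<in> K"
    using open_K p by (rule topological_tendstoD)
  have d: "((\<lambda>s. mink (p + s *\<^sub>R u) z) has_real_derivative d * mink p z) (at_right 0)"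
    if d: "((\<lambda>s. mink p (z + s *\<^sub>R u)) has_real_derivative d) (at 0)" for d z
  proof -
    define \<psi> where "\<psi> = (\<lambda>t. if t = 0 then mink p (u + z - u)
      else mink (p + (t * 1) *\<^sub>R u) ((p + (t * 1) *\<^sub>R (u + z)) - (p + (t * 1) *\<^sub>R u)) / t)"
    have "(\<psi> has_real_derivative mink p (u + z - u) * 0 + d * (0 - 0 + mink p (u + z - u))) (at_right 0)"
      unfolding \<psi>_def
      by (rule mink_chord_expansion(2)[where a = "\<lambda>_. 1" and b = "\<lambda>_. 1", OF p]) (use K d in simp_all)
    then have "((\<lambda>t. (\<psi> t - \<psi> 0) / (t - 0)) \<longlongrightarrow> d * mink p z) (at_right 0)"
      by (simp add: has_field_derivative_iff)
    then have "((\<lambda>t. (mink (p + t *\<^sub>R u) z - mink (p + 0 *\<^sub>R u) z) / (t - 0)) \<longlongrightarrow> d * mink p z) (at_right 0)"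
    proof (rule Lim_transform_eventually)
      show "\<forall>\<^sub>F t in at_right 0. (\<psi> t - \<psi> 0) / (t - 0) =
          (mink (p + t *\<^sub>R u) z - mink (p + 0 *\<^sub>R u) z) / (t - 0)"
        using K eventually_at_right_less[of 0]
      proof eventually_elim
        case (elim t)
        have "(p + (t * 1) *\<^sub>R (u + z)) - (p + (t * 1) *\<^sub>R u) = t *\<^sub>R z" by (simp add: algebra_simps)
        then have "\<psi> t = mink (p + t *\<^sub>R u) z"
          using elim by (simp add: \<psi>_def mink_scaleR)
        moreover have "\<psi> 0 = mink p z" by (simp add: \<psi>_def)
        ultimately show ?case by simp
      qed
    qed
    then show ?thesis by (simp add: has_field_derivative_iff)
  qed
  show ?thesis
    unfolding skew_def by (intro DERIV_cdivide DERIV_diff d fp fm)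
qed

text \<open>If \<open>skew\<close> is linear at every base point, so is its derivative in the base point. On a line this
  derivative is that of \<open>W = (F\<^sup>2 + h\<^sup>2) / 2\<close>, at all smooth points; so \<open>W\<close> has affine subgradients, and
  with \<open>h\<close> affine \<open>F\<^sup>2\<close> is quadratic.\<close>

lemma finsler_square_line:
  assumes p: "p \<in> K" and add: "\<And>x v w. x \<in> K \<Longrightarrow> skew x (v + w) = skew x v + skew x w"
  shows "\<exists>c. \<forall>x. (finsler p (a + x *\<^sub>R b))\<^sup>2 = (finsler p a)\<^sup>2 + c * x + (finsler p b)\<^sup>2 * x\<^sup>2"
proof -
  define S where "S = smooth_on_line p a b"
  have S: "closure S = UNIV" unfolding S_def by (rule closure_smooth_on_line[OF p])
  define m m' where "m x = mink p (a + x *\<^sub>R b)" and "m' x = mink p (- (a + x *\<^sub>R b))" for x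
  define D where "D x = (deriv m x * m x + deriv m' x * m' x) / 2" for x
  have d: "(m has_real_derivative deriv m x) (at x)" "(m' has_real_derivative deriv m' x) (at x)"
    and base: "((\<lambda>s. skew (p + s *\<^sub>R b) (a + x *\<^sub>R b)) has_real_derivative D x) (at_right 0)" if x: "x \<in> S" for x
  proof -
    obtain gp gm where g:
      "(m has_real_derivative gp) (at x)" "(m' has_real_derivative gm) (at x)"
      "((\<lambda>s. mink p (a + x *\<^sub>R b + s *\<^sub>R b)) has_real_derivative gp) (at 0)"
      "((\<lambda>s. mink p (- (a + x *\<^sub>R b) + s *\<^sub>R b)) has_real_derivative - gm) (at 0)"
      using x unfolding S_def m_def[abs_def] m'_def[abs_def] by (elim smooth_on_lineE)
    then have dm: "deriv m x = gp" "deriv m' x = gm" by (auto intro: DERIV_imp_deriv)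
    then show "(m has_real_derivative deriv m x) (at x)" "(m' has_real_derivative deriv m' x) (at x)"
      using g by auto
    show "((\<lambda>s. skew (p + s *\<^sub>R b) (a + x *\<^sub>R b)) has_real_derivative D x) (at_right 0)"
      using skew_base_deriv[OF p g(3,4)] by (simp add: D_def dm m_def m'_def)
  qed
  have meets: "\<exists>x\<in>U. x \<in> S" if "open U" "U \<noteq> {}" for U
    using open_Int_closure_eq_empty[OF that(1), of S] S that(2) by auto
  obtain x0 where x0: "x0 \<in> S" "x0 < 0" using meets[of "{..<0}"] by (auto intro: lt_ex)
  obtain x1 where x1: "x1 \<in> S" "0 < x1" using meets[of "{0<..}"] by (auto intro: gt_ex)
  have lim: "((\<lambda>s. p + s *\<^sub>R b) \<longlongrightarrow> p) (at_right 0)"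
    by (auto intro!: tendsto_eq_intros tendsto_ident_at)
  have inK: "\<forall>\<^sub>F s in at_right 0. p + s *\<^sub>R b \<in> K"
    using lim open_K p by (rule topological_tendstoD)
  \<comment> \<open>Two smooth points determine the affine function, because each \<open>skew (p + s b)\<close> is affine on the line.\<close>
  define \<beta> where "\<beta> = (D x1 - D x0) / (x1 - x0)"
  define \<alpha> where "\<alpha> = D x0 - \<beta> * x0"
  have D_affine: "D x = \<alpha> + \<beta> * x" if x: "x \<in> S" for x
  proof -
    define l where "l = (x - x0) / (x1 - x0)"
    have l: "x = (1 - l) * x0 + l * x1"
    proof -
      have "l * (x1 - x0) = x - x0" using x0 x1 by (simp add: l_def)
      then show ?thesis by (simp add: algebra_simps)
    qed
    define f where "f s = skew (p + s *\<^sub>R b) (a + x *\<^sub>R b) - ((1 - l) * skew (p + s *\<^sub>R b) (a + x0 *\<^sub>R b)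
      + l * skew (p + s *\<^sub>R b) (a + x1 *\<^sub>R b))" for s
    have f0: "f s = 0" if q: "p + s *\<^sub>R b \<in> K" for s
    proof -
      have "a + x *\<^sub>R b = (1 - l) *\<^sub>R (a + x0 *\<^sub>R b) + l *\<^sub>R (a + x1 *\<^sub>R b)"
        by (subst l) (simp add: algebra_simps)
      then show ?thesis by (simp only: f_def add[OF q] skew_scaleR[OF q])
    qed
    have "(f has_real_derivative D x - ((1 - l) * D x0 + l * D x1)) (at_right 0)"
      unfolding f_def[abs_def] by (intro DERIV_diff DERIV_add DERIV_cmult base x x0 x1)
    then have "((\<lambda>s. (f s - f 0) / (s - 0)) \<longlongrightarrow> D x - ((1 - l) * D x0 + l * D x1)) (at_right 0)"
      by (simp add: has_field_derivative_iff)
    moreover have "\<forall>\<^sub>F s in at_right 0. (f s - f 0) / (s - 0) = 0"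
      using inK
    proof eventually_elim
      case (elim s)
      then show ?case using f0[of s] f0[of 0] p by simp
    qed
    then have "((\<lambda>s. (f s - f 0) / (s - 0)) \<longlongrightarrow> 0) (at_right 0)" by (rule tendsto_eventually)
    ultimately have "D x - ((1 - l) * D x0 + l * D x1) = 0"
      by (intro tendsto_unique[OF trivial_limit_at_right_real])
    moreover have "\<beta> * (x - x0) = l * (D x1 - D x0)" by (simp add: \<beta>_def l_def)
    ultimately show ?thesis by (simp add: \<alpha>_def algebra_simps)
  qed
  define W where "W x = ((m x)\<^sup>2 + (m' x)\<^sup>2) / 4" for x
  have contW: "continuous_on UNIV W"
    unfolding W_def[abs_def] m_def m'_def continuous_on_def using p by (auto intro!: tendsto_intros)
  have cvx: "convex_on UNIV m" "convex_on UNIV m'"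
    using convex_on_mink_line[OF p, of a b] convex_on_mink_line[OF p, of "- a" "- b"]
    by (simp_all add: m_def[abs_def] m'_def[abs_def])
  have sub_S: "W x + (\<alpha> + \<beta> * x) * (y - x) \<le> W y" if x: "x \<in> S" for x y
  proof -
    have sq: "(f x)\<^sup>2 + 2 * (f x * f') * (y - x) \<le> (f y)\<^sup>2"
      if "0 \<le> f x" "f x + f' * (y - x) \<le> f y" for f :: "real \<Rightarrow> real" and f'
    proof -
      have "f x * (f x + f' * (y - x)) \<le> f x * f y" using that by (intro mult_left_mono) auto
      moreover have "2 * (f x * f y) \<le> (f x)\<^sup>2 + (f y)\<^sup>2" using sum_squares_bound[of "f x" "f y"] by simp
      ultimately show ?thesis by (simp add: power2_eq_square algebra_simps)
    qed
    have "0 \<le> m x" "0 \<le> m' x" using p by (simp_all add: m_def m'_def)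
    then have "(m x)\<^sup>2 + 2 * (m x * deriv m x) * (y - x) \<le> (m y)\<^sup>2"
      "(m' x)\<^sup>2 + 2 * (m' x * deriv m' x) * (y - x) \<le> (m' y)\<^sup>2"
      using convex_deriv_subgradient[OF cvx(1) d(1)[OF x]] convex_deriv_subgradient[OF cvx(2) d(2)[OF x]]
      by (auto intro: sq)
    then have "W x + D x * (y - x) \<le> W y" by (simp add: W_def D_def field_simps)
    then show ?thesis by (simp add: D_affine[OF x])
  qed
  have "W x + (\<alpha> + \<beta> * x) * (y - x) \<le> W y" for x y
  proof (rule dense_imp_all[OF S, where Q = "\<lambda>x. W x + (\<alpha> + \<beta> * x) * (y - x) \<le> W y"])
    show "closed {x. W x + (\<alpha> + \<beta> * x) * (y - x) \<le> W y}"
      using contW by (intro closed_Collect_le continuous_intros)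
  qed (rule sub_S)
  then have W: "W x = W 0 + \<alpha> * x + \<beta> / 2 * x\<^sup>2" for x
    by (rule quadratic_of_affine_subgradient)
  have WF: "W x = ((finsler p (a + x *\<^sub>R b))\<^sup>2 + (skew p (a + x *\<^sub>R b))\<^sup>2) / 2" for x
    unfolding W_def m_def m'_def mink_eq_finsler_skew(1) finsler_minus skew_minus by (simp add: power2_eq_square field_simps)
  define c c2 where "c = 2 * \<alpha> - 2 * skew p a * skew p b" and "c2 = \<beta> - (skew p b)\<^sup>2"
  have quad: "(finsler p (a + x *\<^sub>R b))\<^sup>2 = (finsler p a)\<^sup>2 + c * x + c2 * x\<^sup>2" for x
    using W[of x] add[OF p] skew_scaleR[OF p] unfolding WF[of x] WF[of 0]
    by (simp add: c_def c2_def power2_eq_square field_simps)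
  have "((\<lambda>x. finsler p (a + x *\<^sub>R b) / x) \<longlongrightarrow> finsler p b) at_top"
    by (rule tendsto_line_at_top) (use p in \<open>auto intro: tendsto_finsler simp: finsler_scaleR\<close>)
  then have "((\<lambda>x. (finsler p (a + x *\<^sub>R b) / x)\<^sup>2) \<longlongrightarrow> (finsler p b)\<^sup>2) at_top"
    by (rule tendsto_power)
  moreover have "((\<lambda>x. (finsler p (a + x *\<^sub>R b) / x)\<^sup>2) \<longlongrightarrow> c2) at_top"
    unfolding power_divide quad by real_asymp
  ultimately have "(finsler p b)\<^sup>2 = c2" by (intro tendsto_unique[OF trivial_limit_at_top_linorder])
  then show ?thesis using quad by auto
qed

end

section \<open>The Hilbert metric of an ellipsoid\<close>

text \<open>The hypotheses on \<open>skew p\<close> and \<open>finsler p\<close> say that \<open>K\<close> is an ellipsoid: its boundary is the quadric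
  \<open>finsler p = 1 - skew p\<close>, where \<open>finsler p\<close> is a Euclidean norm and \<open>skew p\<close> is linear.\<close>

locale convex_ellipsoid = bounded_convex_open +
  fixes p
  assumes p: "p \<in> K"
    and skew_add: "skew p (v + w) = skew p v + skew p w"
    and finsler_square: "\<exists>c. \<forall>x. (finsler p (a + x *\<^sub>R b))\<^sup>2 = (finsler p a)\<^sup>2 + c * x + (finsler p b)\<^sup>2 * x\<^sup>2"
begin

definition ip where "ip v w = ((finsler p (v + w))\<^sup>2 - (finsler p (v - w))\<^sup>2) / 4"

lemma finsler_square_ip: "(finsler p (a + x *\<^sub>R b))\<^sup>2 = (finsler p a)\<^sup>2 + 2 * x * ip a b + x\<^sup>2 * (finsler p b)\<^sup>2"
proof -
  obtain c where c: "(finsler p (a + x *\<^sub>R b))\<^sup>2 = (finsler p a)\<^sup>2 + c * x + (finsler p b)\<^sup>2 * x\<^sup>2" for x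
    using finsler_square by blast
  have "ip a b = c / 2" using c[of 1] c[of "- 1"] by (simp add: ip_def)
  then show ?thesis using c[of x] by simp
qed

lemma ip_self: "ip v v = (finsler p v)\<^sup>2"
  using finsler_scaleR[OF p, of 2 v] p by (simp add: ip_def power2_eq_square flip: scaleR_2)

lemma ip_commute: "ip v w = ip w v"
  using finsler_minus[of p "v - w"] by (simp add: ip_def add.commute)

lemma ip_minus_right: "ip v (- w) = - ip v w"
  by (simp add: ip_def field_simps)

lemma ip_scaleR_right: "ip v (c *\<^sub>R w) = c * ip v w"
  using finsler_square_ip[of v 1 "c *\<^sub>R w"] finsler_square_ip[of v c w] finsler_scaleR[OF p, of c w]
  by (simp add: power_mult_distrib)

lemma parallelogram: "(finsler p (v + w))\<^sup>2 + (finsler p (v - w))\<^sup>2 = 2 * (finsler p v)\<^sup>2 + 2 * (finsler p w)\<^sup>2"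
  using finsler_square_ip[of v 1 w] finsler_square_ip[of v "- 1" w] by simp

text \<open>The argument of Jordan and von Neumann.\<close>

lemma ip_add_left: "ip (a + b) c = ip a c + ip b c"
proof -
  have 1: "ip (a + b) c + ip (a - b) c = 2 * ip a c" for a b
    using parallelogram[of "a + c" b] parallelogram[of "a - c" b]
    by (simp add: ip_def field_simps)
  have "ip (a - b) c = - ip (b - a) c"
    using ip_minus_right[of c "b - a"] by (simp add: ip_commute[of _ c])
  then show ?thesis using 1[of a b] 1[of b a] by (simp add: add.commute)
qed

lemma ip_add_right: "ip c (a + b) = ip c a + ip c b"
  using ip_add_left by (simp add: ip_commute[of c])

text \<open>The polarization of \<open>(1 - skew p)\<^sup>2 - (finsler p)\<^sup>2\<close> on the cone over \<open>K\<close>: points of \<open>K\<close> stand for the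
  timelike lines of a Lorentz space, as in the Klein model.\<close>

definition lorentz where
  "lorentz x y = (1 - skew p (x - p)) * (1 - skew p (y - p)) - ip (x - p) (y - p)"

lemma lorentz_commute: "lorentz x y = lorentz y x"
  by (simp add: lorentz_def ip_commute)

lemma lorentz_convex_comb:
  assumes "\<kappa> + \<mu> = 1"
  shows "lorentz y (\<kappa> *\<^sub>R x + \<mu> *\<^sub>R z) = \<kappa> * lorentz y x + \<mu> * lorentz y z"
proof -
  have "\<kappa> *\<^sub>R x + \<mu> *\<^sub>R z - p = \<kappa> *\<^sub>R (x - p) + \<mu> *\<^sub>R (z - p) + (\<kappa> + \<mu> - 1) *\<^sub>R p"
    by (simp add: algebra_simps)
  then have e: "\<kappa> *\<^sub>R x + \<mu> *\<^sub>R z - p = \<kappa> *\<^sub>R (x - p) + \<mu> *\<^sub>R (z - p)" using assms by simp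
  have l: "\<kappa> = 1 - \<mu>" using assms by simp
  show ?thesis
    unfolding lorentz_def e skew_add skew_scaleR[OF p] ip_add_right ip_scaleR_right
    unfolding l by (simp add: algebra_simps)
qed

lemma lorentz_pos:
  assumes "x \<in> K"
  shows "0 < lorentz x x"
proof -
  have "finsler p (x - p) < 1 - skew p (x - p)"
    using mink_diff_less_1[OF p, of x] assms by (simp add: mink_eq_finsler_skew)
  then have "(finsler p (x - p))\<^sup>2 < (1 - skew p (x - p))\<^sup>2"
    using p by (intro power_strict_mono) auto
  then show ?thesis by (simp add: lorentz_def ip_self power2_eq_square)
qed

text \<open>By rebasing to \<open>p\<close>, \<open>mink x z\<close> and \<open>- mink x (- z)\<close> are the two roots of one quadratic equation with
  leading coefficient \<open>lorentz x x\<close>; their sum and product give the cosine formula.\<close>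

lemma cosh_hilbert_dist:
  assumes x: "x \<in> K" and y: "y \<in> K"
  shows "lorentz x y = sqrt (lorentz x x) * sqrt (lorentz y y) * cosh (dK x y)"
proof (cases "x = y")
  case True
  then show ?thesis using lorentz_pos[OF x] by (simp add: hilbert_dist_def)
next
  case False
  define z u where "z = y - x" and "u = x - p"
  have z: "z \<noteq> 0" using False by (simp add: z_def)
  define g g' where "g = mink x z" and "g' = mink x (- z)"
  define L where "L = lorentz x x"
  have L: "0 < L" "L = (1 - skew p u)\<^sup>2 - (finsler p u)\<^sup>2"
    using lorentz_pos[OF x] by (simp_all add: L_def lorentz_def u_def ip_self power2_eq_square)
  define M where "M = (1 - skew p u) * skew p z + ip z u"
  have gpos: "0 < g" "0 < g'" "g < 1"
    using z x y mink_pos by (auto simp: g_def g'_def z_def mink_diff_less_1)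
  have root: "r\<^sup>2 * L - 2 * r * ((1 - skew p u) * skew p v + ip v u) + (skew p v)\<^sup>2 - (finsler p v)\<^sup>2 = 0"
    if r: "r = mink x v" for r v
  proof -
    have "mink p (v + r *\<^sub>R u) = r"
      using mink_rebase_self[OF p x, of v] by (simp add: r u_def)
    then have "finsler p (v + r *\<^sub>R u) = r - skew p v - r * skew p u"
      by (simp add: mink_eq_finsler_skew skew_add skew_scaleR[OF p])
    then have "(r - skew p v - r * skew p u)\<^sup>2 = (finsler p v)\<^sup>2 + 2 * r * ip v u + r\<^sup>2 * (finsler p u)\<^sup>2"
      using finsler_square_ip[of v r u] by simp
    then show ?thesis by (simp add: L(2) power2_eq_square algebra_simps)
  qed
  have 1: "g\<^sup>2 * L - 2 * g * M + (skew p z)\<^sup>2 - (finsler p z)\<^sup>2 = 0"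
    using root[OF g_def] by (simp add: M_def)
  have "ip (- z) u = - ip z u" using ip_minus_right[of u z] by (simp add: ip_commute[of _ u])
  then have 2: "g'\<^sup>2 * L + 2 * g' * M + (skew p z)\<^sup>2 - (finsler p z)\<^sup>2 = 0"
    using root[OF g'_def] by (simp add: M_def algebra_simps)
  have "(g + g') * ((g - g') * L - 2 * M) = 0"
    using 1 2 by (simp add: power2_eq_square algebra_simps)
  then have M: "2 * M = (g - g') * L" using gpos by simp
  have prod: "(finsler p z)\<^sup>2 - (skew p z)\<^sup>2 = g * g' * L"
  proof -
    have "(finsler p z)\<^sup>2 - (skew p z)\<^sup>2 = g * g * L - g * (2 * M)"
      using 1 by (simp add: power2_eq_square)
    then show ?thesis unfolding M by (simp add: algebra_simps)
  qed
  have yp: "y - p = u + z" by (simp add: u_def z_def)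
  have Lxy: "lorentz x y = L * ((1 + g') + (1 - g)) / 2"
  proof -
    have "lorentz x y = L - M"
      unfolding lorentz_def yp u_def[symmetric] skew_add ip_add_right ip_self L(2) M_def
      by (simp add: ip_commute[of z] power2_eq_square algebra_simps)
    then show ?thesis using M by (simp add: field_simps)
  qed
  have Lyy: "lorentz y y = L * ((1 + g') * (1 - g))"
  proof -
    have "lorentz y y = L - 2 * M - ((finsler p z)\<^sup>2 - (skew p z)\<^sup>2)"
      unfolding lorentz_def yp skew_add ip_add_right ip_add_left
      unfolding ip_self L(2) M_def
      by (simp add: ip_commute[of z] ip_self power2_eq_square algebra_simps)
    then show ?thesis unfolding M prod by (simp add: algebra_simps)
  qed
  define q where "q = sqrt ((1 + g') / (1 - g))"
  have q: "0 < q" "q\<^sup>2 = (1 + g') / (1 - g)" using gpos by (simp_all add: q_def)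
  have "dK x y = ln ((1 + g') / (1 - g)) / 2"
    using hilbert_dist_line[OF x, of 0 1 z] gpos by (simp add: g_def g'_def z_def)
  also have "\<dots> = ln q" using gpos by (simp add: q_def ln_sqrt)
  finally have "cosh (dK x y) = (q + inverse q) / 2" using q by (simp add: cosh_ln_real)
  also have "\<dots> = ((1 + g') + (1 - g)) / (2 * (q * (1 - g)))"
  proof -
    have e: "(1 + g') + (1 - g) = (q\<^sup>2 + 1) * (1 - g)" using gpos unfolding q(2) by (simp add: field_simps)
    have "(q + inverse q) / 2 = (q\<^sup>2 + 1) / (2 * q)"
      using q(1) by (simp add: power2_eq_square field_simps)
    also have "\<dots> = ((q\<^sup>2 + 1) * (1 - g)) / ((2 * q) * (1 - g))"
      using gpos(3) by (intro mult_divide_mult_cancel_right[symmetric]) simp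
    finally show ?thesis unfolding e by (simp only: mult.assoc)
  qed
  finally have cosh: "cosh (dK x y) = ((1 + g') + (1 - g)) / (2 * (q * (1 - g)))" .
  have "sqrt ((1 + g') * (1 - g)) = q * (1 - g)"
  proof (rule real_sqrt_unique)
    have "(q * (1 - g))\<^sup>2 = q\<^sup>2 * (1 - g)\<^sup>2" by (simp add: power_mult_distrib)
    then show "(q * (1 - g))\<^sup>2 = (1 + g') * (1 - g)"
      unfolding q(2) using gpos by (simp add: power2_eq_square)
  qed (use q gpos in simp)
  then have sq: "sqrt (lorentz x x) * sqrt (lorentz y y) = L * (q * (1 - g))"
    unfolding Lyy L_def[symmetric] using L by (simp add: real_sqrt_mult)
  define r where "r = q * (1 - g)"
  have "r \<noteq> 0" using q gpos by (simp add: r_def)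
  then show ?thesis unfolding Lxy cosh sq r_def[symmetric] by simp
qed

text \<open>On the hyperboloid, the point dividing the geodesic from \<open>x\<close> to \<open>z\<close> in the ratio \<open>t : 1 - t\<close> is a combination of
  unit vectors over \<open>x\<close> and \<open>z\<close> with the weights \<open>sinh ((1 - t) D)\<close> and \<open>sinh (t D)\<close>. Bilinearity then gives
  its distance from every point of \<open>K\<close> at once, which is Stewart's theorem.\<close>

lemma division_point:
  assumes x: "x \<in> K" and z: "z \<in> K" and D: "D = dK x z" "0 < D" and t: "t \<in> {0..1}"
  obtains m where "m \<in> K" "\<And>y. y \<in> K \<Longrightarrow>
    sinh D * cosh (dK y m) = sinh ((1 - t) * D) * cosh (dK y x) + sinh (t * D) * cosh (dK y z)"
proof -
  define a b where "a = sinh ((1 - t) * D)" and "b = sinh (t * D)"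
  define \<kappa> \<mu> where "\<kappa> = a / sqrt (lorentz x x)" and "\<mu> = b / sqrt (lorentz z z)"
  have Lx: "0 < sqrt (lorentz x x)" and Lz: "0 < sqrt (lorentz z z)" using lorentz_pos x z by auto
  have ab: "0 \<le> a" "0 \<le> b" "0 < a \<or> 0 < b"
  proof -
    have "0 \<le> (1 - t) * D" "0 \<le> t * D" using t D(2) by (auto intro: mult_nonneg_nonneg)
    moreover have "0 < (1 - t) * D \<or> 0 < t * D" using t D(2) by (cases "t = 0") auto
    ultimately show "0 \<le> a" "0 \<le> b" "0 < a \<or> 0 < b" by (simp_all only: a_def b_def) auto
  qed
  have lm: "0 \<le> \<kappa>" "0 \<le> \<mu>" using ab Lx Lz by (auto simp: \<kappa>_def \<mu>_def)
  define s where "s = \<kappa> + \<mu>"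
  have s: "0 < s" using ab Lx Lz lm by (auto simp: s_def \<kappa>_def \<mu>_def add_pos_nonneg add_nonneg_pos)
  define m where "m = (\<kappa> / s) *\<^sub>R x + (\<mu> / s) *\<^sub>R z"
  have one: "\<kappa> / s + \<mu> / s = 1" using s by (simp add: s_def flip: add_divide_distrib)
  have m: "m \<in> K" unfolding m_def using convex x z lm s one by (intro convexD) auto
  have sm: "s * lorentz y m = \<kappa> * lorentz y x + \<mu> * lorentz y z" for y
    unfolding m_def lorentz_convex_comb[OF one] using s by (simp add: field_simps)
  have cm: "s * lorentz y m = sqrt (lorentz y y) * (a * cosh (dK y x) + b * cosh (dK y z))" if y: "y \<in> K" for y
    unfolding sm cosh_hilbert_dist[OF y x] cosh_hilbert_dist[OF y z] \<kappa>_def \<mu>_def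
    using Lx Lz by (simp add: algebra_simps)
  have zero: "dK x x = 0" for x by (simp add: hilbert_dist_def)
  have comm: "dK z x = D" using Metric_space.commute[OF Metric_space_hilbert_dist] D by simp
  have "s * (s * lorentz m m) = \<kappa> * (s * lorentz x m) + \<mu> * (s * lorentz z m)"
    unfolding sm[of m] by (simp add: lorentz_commute[of m] algebra_simps)
  also have "\<dots> = a * (a + b * cosh D) + b * (a * cosh D + b)"
    unfolding cm[OF x] cm[OF z] zero comm D(1)[symmetric] \<kappa>_def \<mu>_def using Lx Lz by simp
  also have "\<dots> = (sinh D)\<^sup>2"
  proof -
    define A B where "A = (1 - t) * D" and "B = t * D"
    have AB: "A + B = D" by (simp add: A_def B_def algebra_simps)
    have c: "cosh A * cosh A = 1 + sinh A * sinh A" "cosh B * cosh B = 1 + sinh B * sinh B"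
      using cosh_square_eq[of A] cosh_square_eq[of B] by (simp_all add: power2_eq_square)
    have "(sinh (A + B))\<^sup>2 = sinh A * sinh A * (cosh B * cosh B) + sinh B * sinh B * (cosh A * cosh A)
        + 2 * sinh A * sinh B * (cosh A * cosh B)"
      by (simp add: sinh_add power2_eq_square algebra_simps)
    also have "\<dots> = sinh A * (sinh A + sinh B * cosh (A + B)) + sinh B * (sinh A * cosh (A + B) + sinh B)"
      unfolding c cosh_add by (simp add: algebra_simps)
    finally show ?thesis unfolding AB by (simp add: a_def b_def A_def B_def algebra_simps)
  qed
  finally have "s * (s * lorentz m m) = (sinh D)\<^sup>2" .
  moreover have "(s * sqrt (lorentz m m))\<^sup>2 = s * (s * lorentz m m)"
    using lorentz_pos[OF m] by (simp add: power_mult_distrib power2_eq_square[of s])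
  ultimately have smm: "s * sqrt (lorentz m m) = sinh D"
    using s D(2) lorentz_pos[OF m] by (simp add: power2_eq_imp_eq)
  show thesis
  proof (rule that[OF m])
    fix y assume y: "y \<in> K"
    have "sqrt (lorentz y y) * (sinh D * cosh (dK y m)) = s * lorentz y m"
      unfolding cosh_hilbert_dist[OF y m] smm[symmetric] by simp
    also have "\<dots> = sqrt (lorentz y y) * (a * cosh (dK y x) + b * cosh (dK y z))" by (rule cm[OF y])
    finally show "sinh D * cosh (dK y m) = sinh ((1 - t) * D) * cosh (dK y x) + sinh (t * D) * cosh (dK y z)"
      using lorentz_pos[OF y] by (simp add: a_def b_def)
  qed
qed

text \<open>Stewart's theorem for \<open>y = \<gamma> t\<close> shows that \<open>\<gamma> t\<close> has distance \<open>0\<close> from the division point. So geodesics are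
  unique, and the theorem applies to \<open>\<gamma> t\<close>.\<close>

lemma alexandrov_inequality:
  assumes geo: "Metric_space.shortest_geodesic K dK \<gamma>" and y: "y \<in> K" and t: "t \<in> {0..1}"
  shows "(dK y (\<gamma> t))\<^sup>2 \<le> (1 - t) * (dK y (\<gamma> 0))\<^sup>2 + t * (dK y (\<gamma> 1))\<^sup>2 - t * (1 - t) * (dK (\<gamma> 0) (\<gamma> 1))\<^sup>2"
proof -
  interpret Metric_space K dK by (rule Metric_space_hilbert_dist)
  note g = shortest_geodesic_dist[OF geo]
  define x z D where "x = \<gamma> 0" and "z = \<gamma> 1" and "D = dK x z"
  have K: "x \<in> K" "z \<in> K" "\<gamma> t \<in> K" using g(1)[of 0] g(1)[of 1] g(1)[OF t] by (auto simp: x_def z_def)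
  have dt: "dK (\<gamma> t) x = t * D" "dK (\<gamma> t) z = (1 - t) * D"
    using g(2,3)[OF t] commute by (simp_all add: x_def z_def D_def)
  show ?thesis
  proof (cases "D = 0")
    case True
    then have "z = x" "\<gamma> t = x" using K dt by (simp_all add: D_def)
    then show ?thesis using True by (simp add: x_def[symmetric] z_def[symmetric] D_def algebra_simps)
  next
    case False
    then have D: "0 < D" by (simp add: D_def less_le)
    obtain m where m: "m \<in> K" "\<And>y. y \<in> K \<Longrightarrow>
        sinh D * cosh (dK y m) = sinh ((1 - t) * D) * cosh (dK y x) + sinh (t * D) * cosh (dK y z)"
      using division_point[OF K(1,2) D_def D t] by blast
    have "sinh D * cosh (dK (\<gamma> t) m) = sinh ((1 - t) * D + t * D)"
      unfolding m(2)[OF K(3)] dt sinh_add by simp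
    also have "(1 - t) * D + t * D = D" by (simp add: algebra_simps)
    finally have "cosh (dK (\<gamma> t) m) = 1" using D by simp
    then have "dK (\<gamma> t) m = 0"
      using cosh_real_nonneg_less_iff[of 0 "dK (\<gamma> t) m"] by (metis cosh_0 less_irrefl less_le nonneg order_refl)
    then have "\<gamma> t = m" using K m(1) by simp
    then have "sinh D * cosh (dK y (\<gamma> t)) = sinh ((1 - t) * D) * cosh (dK y x) + sinh (t * D) * cosh (dK y z)"
      using m(2)[OF y] by simp
    then show ?thesis
      unfolding x_def[symmetric] z_def[symmetric] D_def[symmetric]
      using triangle[of y z x] triangle[of y x z] triangle[of x y z] K y D t
      by (intro hyperbolic_cevian_le) (auto simp: D_def commute[of x y] commute[of z x])
  qed
qed

end

section \<open>The equivalence of the two curvature conditions\<close>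

context bounded_convex_open
begin

lemma busemann_imp_rays_diverge:
  assumes npc: "Metric_space.busemann_npc_space K dK" and p: "p \<in> K"
  shows "rays_diverge p"
proof -
  interpret Metric_space K dK by (rule Metric_space_hilbert_dist)
  obtain \<delta> where "0 < \<delta> \<and> (\<forall>\<gamma>\<^sub>1 \<gamma>\<^sub>2.
        shortest_geodesic \<gamma>\<^sub>1 \<and> shortest_geodesic \<gamma>\<^sub>2 \<and>
        \<gamma>\<^sub>1 0 = \<gamma>\<^sub>2 0 \<and> \<gamma>\<^sub>1 0 \<in> mball p \<delta> \<and> \<gamma>\<^sub>1 1 \<in> mball p \<delta> \<and> \<gamma>\<^sub>2 1 \<in> mball p \<delta> \<longrightarrow>
          dK (\<gamma>\<^sub>1 (1 / 2)) (\<gamma>\<^sub>2 (1 / 2)) \<le> 1 / 2 * dK (\<gamma>\<^sub>1 1) (\<gamma>\<^sub>2 1))"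
    using bspec[OF conjunct2[OF npc[unfolded busemann_npc_space_def]] p] ..
  then have "0 < \<delta>" and mid: "\<And>\<gamma>\<^sub>1 \<gamma>\<^sub>2. \<lbrakk>shortest_geodesic \<gamma>\<^sub>1; shortest_geodesic \<gamma>\<^sub>2;
        \<gamma>\<^sub>1 0 = \<gamma>\<^sub>2 0; \<gamma>\<^sub>1 0 \<in> mball p \<delta>; \<gamma>\<^sub>1 1 \<in> mball p \<delta>; \<gamma>\<^sub>2 1 \<in> mball p \<delta>\<rbrakk> \<Longrightarrow>
          dK (\<gamma>\<^sub>1 (1 / 2)) (\<gamma>\<^sub>2 (1 / 2)) \<le> 1 / 2 * dK (\<gamma>\<^sub>1 1) (\<gamma>\<^sub>2 1)"
    by blast+
  have "t * finsler p (w - v) \<le> dK (ray p v t) (ray p w t)"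
    if t: "0 \<le> t" "t * finsler p v < \<delta>" "t * finsler p w < \<delta>" and vw: "v \<noteq> 0" "w \<noteq> 0" for v w t
  proof (rule hilbert_dist_rays_ge[OF p t vw])
    fix \<gamma> \<gamma>' assume geo: "shortest_geodesic \<gamma>" "shortest_geodesic \<gamma>'"
      and "\<gamma> 0 = p" "\<gamma>' 0 = p" "dK p (\<gamma> 1) < \<delta>" "dK p (\<gamma>' 1) < \<delta>"
    moreover have "\<gamma> 1 \<in> K" "\<gamma>' 1 \<in> K"
      using shortest_geodesic_dist(1)[OF geo(1), of 1] shortest_geodesic_dist(1)[OF geo(2), of 1] by auto
    ultimately show "dK (\<gamma> (1 / 2)) (\<gamma>' (1 / 2)) \<le> 1 / 2 * dK (\<gamma> 1) (\<gamma>' 1)"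
      using p \<open>0 < \<delta>\<close> by (intro mid) auto
  qed
  then show ?thesis using \<open>0 < \<delta>\<close> unfolding rays_diverge_def by blast
qed

lemma busemann_imp_ellipsoid:
  assumes npc: "Metric_space.busemann_npc_space K dK" and p: "p \<in> K"
  shows "convex_ellipsoid K p"
proof unfold_locales
  have add: "skew x (v + w) = skew x v + skew x w" if "x \<in> K" for x v w
    using that npc by (intro skew_add busemann_imp_rays_diverge)
  show "p \<in> K" by (rule p)
  show "skew p (v + w) = skew p v + skew p w" for v w by (rule add[OF p])
  show "\<exists>c. \<forall>x. (finsler p (a + x *\<^sub>R b))\<^sup>2 = (finsler p a)\<^sup>2 + c * x + (finsler p b)\<^sup>2 * x\<^sup>2" for a b
    by (rule finsler_square_line[OF p add])
qed

lemma busemann_imp_alexandrov: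
  assumes npc: "Metric_space.busemann_npc_space K dK"
  shows "Metric_space.alexandrov_npc_space K dK"
proof -
  interpret Metric_space K dK by (rule Metric_space_hilbert_dist)
  have "locally_geodesic_space" using npc by (simp add: busemann_npc_space_def)
  moreover have "(dK y (\<gamma> t))\<^sup>2 \<le>
      (1 - t) * (dK y (\<gamma> 0))\<^sup>2 + t * (dK y (\<gamma> 1))\<^sup>2 - t * (1 - t) * (dK (\<gamma> 0) (\<gamma> 1))\<^sup>2"
    if "y \<in> K" "shortest_geodesic \<gamma>" "t \<in> {0..1}" for y \<gamma> t
    using convex_ellipsoid.alexandrov_inequality[OF busemann_imp_ellipsoid[OF npc that(1)] that(2,1,3)] .
  ultimately show ?thesis
    unfolding alexandrov_npc_space_def by (intro conjI ballI exI[of _ "1::real"]) auto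
qed

end

theorem proposition3p4:
  fixes K :: "(real ^ 'n) set"
  assumes "CARD('n) \<ge> 2"
    and "bounded K" and "convex K" and "open K"
  shows "Metric_space.busemann_npc_space K (hilbert_dist K) \<longleftrightarrow>
         Metric_space.alexandrov_npc_space K (hilbert_dist K)"
proof -
  interpret bounded_convex_open K using assms by unfold_locales
  show ?thesis
    using busemann_imp_alexandrov Metric_space.alexandrov_imp_busemann[OF Metric_space_hilbert_dist] by blast
qed

end
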